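(* For infinitely many integers $k$, there exists a square regular $0,1$ matrix $M$ satisfying \[\mathrm{rank}_{\mathrm{bin}}(M) = k \quad\text{and}\quad \mathrm{rank}_{\mathbb{B}}(\overline{M}) \geq k^{\widetilde{\Omega}(\log k)}.\] That is, there are absolute constants $a>0$ and $b\ge 0$ such that for infinitely many integers $k\ge 4$ there is a square regular $0,1$ matrix $M$ with $\mathrm{rank}_{\mathrm{bin}}(M)=k$ and $\mathrm{rank}_{\mathbb{B}}(\overline{M}) \ge k^{a\log_2 k/(\log_2\log_2 k)^b}$.
   Context: A $0,1$ matrix is regular if there is an integer $d$ such that every row and every column of it has precisely $d$ ones. For a $0,1$ matrix $M$, $\overline{M}$ is the complement matrix, obtained by replacing the ones by zeros and the zeros by ones. For a $0,1$ matrix $M$ of dimensions $n\times m$: the binary rank $\mathrm{rank}_{\mathrm{bin}}(M)$ is the minimal $k$ for which there are $0,1$ matrices $A$ ($n\times k$) and $B$ ($k\times m$) with $M=A\cdot B$ over $\mathbb{R}$; equivalently, the smallest number of combinatorial rectangles $P\times Q$ ($P$ a set of rows, $Q$ a set of columns), all of whose entries in $M$ are ones, that partition the ones of $M$. The Boolean rank $\mathrm{rank}_{\mathbb{B}}(M)$ is the minimal $k$ for which such $0,1$ matrices exist with $M=A\cdot B$ under Boolean arithmetic ($1+1=1$); equivalently, the smallest number of combinatorial rectangles of ones of $M$ that cover the ones of $M$ (overlaps allowed). The notation $\widetilde{\Omega}(\log k)$ hides factors polynomial in $\log\log k$. *)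

theory Defs
  imports Complex_Main "Jordan_Normal_Form.Matrix"
begin

definition zero_one_mat :: "real mat \<Rightarrow> bool" where
  "zero_one_mat M \<longleftrightarrow> elements_mat M \<subseteq> {0, 1}"

definition regular_mat :: "real mat \<Rightarrow> bool" where
  "regular_mat M \<longleftrightarrow> zero_one_mat M \<and>
     (\<exists>d. (\<forall>i < dim_row M. card {j. j < dim_col M \<and> M $$ (i, j) = 1} = d) \<and>
          (\<forall>j < dim_col M. card {i. i < dim_row M \<and> M $$ (i, j) = 1} = d))"

definition complement_mat :: "real mat \<Rightarrow> real mat" where
  "complement_mat M = map_mat (\<lambda>x. 1 - x) M"

text \<open>The product of \<open>0,1\<close> matrices in Boolean arithmetic (\<open>1 + 1 = 1\<close>), where the sum of
  the products of entries is a disjunction of conjunctions.\<close>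
definition boolean_mult_mat :: "real mat \<Rightarrow> real mat \<Rightarrow> real mat" where
  "boolean_mult_mat A B = mat (dim_row A) (dim_col B)
     (\<lambda>(i, j). if \<exists>l < dim_col A. A $$ (i, l) = 1 \<and> B $$ (l, j) = 1 then 1 else 0)"

definition binary_factorization :: "real mat \<Rightarrow> nat \<Rightarrow> bool" where
  "binary_factorization M k \<longleftrightarrow>
     (\<exists>A \<in> carrier_mat (dim_row M) k. \<exists>B \<in> carrier_mat k (dim_col M).
        zero_one_mat A \<and> zero_one_mat B \<and> M = A * B)"

definition boolean_factorization :: "real mat \<Rightarrow> nat \<Rightarrow> bool" where
  "boolean_factorization M k \<longleftrightarrow>
     (\<exists>A \<in> carrier_mat (dim_row M) k. \<exists>B \<in> carrier_mat k (dim_col M).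
        zero_one_mat A \<and> zero_one_mat B \<and> M = boolean_mult_mat A B)"

text \<open>The ranks are meant for \<open>0,1\<close> matrices only, for which the minimum exists by the two
  lemmas below.\<close>
definition binary_rank :: "real mat \<Rightarrow> nat" where
  "binary_rank M = (LEAST k. binary_factorization M k)"

definition boolean_rank :: "real mat \<Rightarrow> nat" where
  "boolean_rank M = (LEAST k. boolean_factorization M k)"

lemma zero_one_mat_one: "zero_one_mat (1\<^sub>m n)"
  unfolding zero_one_mat_def by (auto dest!: elements_matD split: if_splits)

lemma binary_factorization_dim_row:
  assumes "zero_one_mat M"
  shows "binary_factorization M (dim_row M)"
  unfolding binary_factorization_def
  by (rule bexI[of _ "1\<^sub>m (dim_row M)"], rule bexI[of _ M])
    (use assms zero_one_mat_one in auto)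

lemma boolean_factorization_dim_row:
  assumes "zero_one_mat M"
  shows "boolean_factorization M (dim_row M)"
proof -
  have "M = boolean_mult_mat (1\<^sub>m (dim_row M)) M"
  proof (rule eq_matI)
    fix i j
    assume "i < dim_row (boolean_mult_mat (1\<^sub>m (dim_row M)) M)"
      and "j < dim_col (boolean_mult_mat (1\<^sub>m (dim_row M)) M)"
    then have ij: "i < dim_row M" "j < dim_col M"
      by (simp_all add: boolean_mult_mat_def)
    then have "M $$ (i, j) \<in> {0, 1}"
      using assms unfolding zero_one_mat_def by (blast intro: elements_matI[OF carrier_matI])
    moreover have "(\<exists>l < dim_row M. (1\<^sub>m (dim_row M) :: real mat) $$ (i, l) = 1 \<and> M $$ (l, j) = 1)
        \<longleftrightarrow> M $$ (i, j) = 1"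
      using ij by (metis index_one_mat(1) zero_neq_one)
    ultimately show "M $$ (i, j) = boolean_mult_mat (1\<^sub>m (dim_row M)) M $$ (i, j)"
      using ij by (auto simp: boolean_mult_mat_def)
  qed (simp_all add: boolean_mult_mat_def)
  then show ?thesis
    unfolding boolean_factorization_def
    by (intro bexI[of _ "1\<^sub>m (dim_row M)"] bexI[of _ M])
      (use assms zero_one_mat_one in auto)
qed

end

(*
The starting point is a pair of cross-intersecting families of small sets of cells, indexed by two
players of a game on the tree of simultaneous binary moves: however an adversary deletes at most h
cells of one player, that player has a set of about sqrt h cells avoiding the deletions, because
he can steer away from the more damaged half of the tree at every deleted node while his opponent
answers arbitrarily. Read as certificates of the values 1 and 0 of a partial function, and combined
by a lookup table (cheat sheet) that stores the certificates of several copies, the two families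
give an unambiguous DNF of width w with w about sqrt h up to logarithmic factors, and a falsifying
assignment z none of whose certificates has size at most h.

Every variable is then replaced by an index gadget. Unambiguity turns the DNF into a partition of
the ones of the resulting matrix into 2^(O~(w)) rectangles. For the zeros, a rectangle containing
too many of the entries over z would, after fixing few coordinates as in z, be spread on the
remaining ones and hence contain an entry satisfying the DNF.
*)
theory Submission
  imports Defs "HOL-Library.FuncSet"
begin

text \<open>The exponents of the two ranks differ quadratically because they see different
  quantities: the rectangles of ones are governed by the width \<open>w\<close> of the terms, the
  cover of the zeros by the certificate size \<open>h\<close> of one assignment, and
  \<open>h\<close> is about the square of \<open>w\<close>. Two certificates of the same value need
  not contradict each other, so the families alone are not unambiguous; storing the certificates in
  the entry addressed by the values of the copies pins down one choice. The address needs
  \<open>t\<close> bits with \<open>h < 2 ^ t\<close>, so that no small set of variables inspects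
  every entry. In the lifting step, row and column of an entry over \<open>z\<close> are correlated.
  Rows are therefore weighted by their columns over \<open>z\<close>, and these columns are compared
  with all columns at the cost of a factor \<open>q\<close> per variable. The failure probability is
  exponentially small in \<open>k\<close>, so a gadget of size polynomial in the number of variables
  pays for this, and its size enters the exponent of the binary rank only through a
  logarithm.\<close>

section \<open>Cross-intersecting families from a game tree\<close>

definition below :: "'a \<Rightarrow> 'a list set \<Rightarrow> 'a list set" where
  "below c A = {v. c # v \<in> A}"

text \<open>\<open>x\<close> is always the move of player \<open>s\<close> and \<open>y\<close> that
  of the opponent, so that a single recursion serves both sides.\<close>

definition move :: "bool \<Rightarrow> bool \<Rightarrow> bool \<Rightarrow> bool \<times> bool" where
  "move s x y = (if s then (x, y) else (y, x))"

text \<open>A certificate follows both answers of the opponent, so the damage of a move is the total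
  over both.\<close>

definition load :: "bool \<Rightarrow> (bool \<times> bool) list set \<Rightarrow> bool \<Rightarrow> nat" where
  "load s A x = (\<Sum>y\<in>UNIV. card (below (move s x y) A))"

definition light_move :: "bool \<Rightarrow> (bool \<times> bool) list set \<Rightarrow> bool" where
  "light_move s A = (load s A True \<le> load s A False)"

text \<open>Nodes of the game tree are lists of pairs of simultaneous moves, with the moves of player
  \<open>True\<close> as first components. Every node \<open>v\<close> carries the cells \<open>(True, v)\<close> and \<open>(False, v)\<close>. In
  the certificate of player \<open>s\<close> below, \<open>A\<close> is the set of nodes \<open>v\<close> whose cell \<open>(s, v)\<close> is
  deleted; the player stops at the first surviving node, and at a deleted one makes the move with
  fewer deletions below it and follows both answers.\<close>
fun cert :: "bool \<Rightarrow> nat \<Rightarrow> (bool \<times> bool) list set \<Rightarrow> (bool \<times> (bool \<times> bool) list) set" where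
  "cert s 0 A = insert (\<not> s, []) (if [] \<in> A then {} else {(s, [])})"
| "cert s (Suc n) A = insert (\<not> s, []) (if [] \<in> A
     then \<Union>y. apsnd ((#) (move s (light_move s A) y)) ` cert s n (below (move s (light_move s A) y) A)
     else {(s, [])})"

lemma finite_below: "finite A \<Longrightarrow> finite (below c A)"
  unfolding below_def by (rule finite_subset[of _ "tl ` A"]) (force intro: image_eqI)+

text \<open>The root and the four subtrees below it are disjoint parts of \<open>A\<close>, and each
  move of player \<open>s\<close> owns two of the subtrees.\<close>

lemma card_below:
  fixes A :: "(bool \<times> bool) list set"
  assumes "finite A"
  shows "card ({[]} \<inter> A) + load s A True + load s A False \<le> card A"
proof -
  have 1: "card ((#) c ` below c A) = card (below c A)" for c
    by (rule card_image) auto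
  have "card (\<Union>c\<in>UNIV. (#) c ` below c A) = (\<Sum>c\<in>UNIV. card ((#) c ` below c A))"
    using assms by (intro card_UN_disjoint) (auto intro: finite_below)
  also have "\<dots> = (\<Sum>x\<in>UNIV. \<Sum>y\<in>UNIV. card (below (x, y) A))"
    by (simp add: 1 sum.cartesian_product UNIV_Times_UNIV[symmetric] del: UNIV_Times_UNIV)
  also have "\<dots> = load s A True + load s A False"
    by (simp add: load_def move_def UNIV_bool)
  finally have 2: "card (\<Union>c\<in>UNIV. (#) c ` below c A) = load s A True + load s A False" .
  have "card (({[]} \<inter> A) \<union> (\<Union>c\<in>UNIV. (#) c ` below c A)) = card ({[]} \<inter> A) + card (\<Union>c\<in>UNIV. (#) c ` below c A)"
    using assms by (intro card_Un_disjoint) (auto intro: finite_below)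
  moreover have "card (({[]} \<inter> A) \<union> (\<Union>c\<in>UNIV. (#) c ` below c A)) \<le> card A"
    using assms by (intro card_mono) (auto simp: below_def)
  ultimately show ?thesis using 2 by simp
qed

lemma load_light_move:
  assumes "finite A" "[] \<in> A"
  shows "2 * load s A (light_move s A) < card A"
proof -
  have "card ({[]} \<inter> A) = 1" using assms by (simp add: Int_absorb2)
  then show ?thesis
    using card_below[OF assms(1), of s]
    by (cases "load s A True \<le> load s A False") (simp_all add: light_move_def)
qed

lemma card_below_light_move:
  assumes "finite A" "[] \<in> A"
  shows "2 * card (below (move s (light_move s A) y) A) < card A"
proof -
  have "card (below (move s (light_move s A) y) A) \<le> load s A (light_move s A)"
    unfolding load_def by (cases y) (auto simp: UNIV_bool)
  then show ?thesis using load_light_move[OF assms, of s] by simp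
qed

lemma cert_finite: "finite (cert s n A)"
  by (induction n arbitrary: A) auto

lemma cert_nonempty: "cert s n A \<noteq> {}"
  by (cases n) auto

lemma cert_length: "(b, v) \<in> cert s n A \<Longrightarrow> length v \<le> n"
proof (induction n arbitrary: A v)
  case (Suc n)
  then show ?case by (fastforce split: if_splits)
qed (auto split: if_splits)

lemma cert_avoids: "(s, v) \<in> cert s n A \<Longrightarrow> v \<notin> A"
proof (induction n arbitrary: A v)
  case (Suc n)
  then show ?case by (fastforce split: if_splits simp: below_def)
qed (auto split: if_splits)

text \<open>Both certificates descend along the branch of the moves of both players until a
  node survives for one of them; the deletions of the first player at least halve along it.\<close>
lemma cert_intersect:
  assumes "finite A" "card A < 2 ^ n"
  shows "cert True n A \<inter> cert False n B \<noteq> {}"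
  using assms
proof (induction n arbitrary: A B)
  case 0
  then show ?case by auto
next
  case (Suc n)
  show ?case
  proof (cases "[] \<in> A \<and> [] \<in> B")
    case True
    \<comment> \<open>Each certificate branches over all answers of the opponent, in particular over
      the opponent's light move, so both contain the branch of the joint move.\<close>
    let ?x = "light_move True A" and ?y = "light_move False B"
    let ?c = "(?x, ?y)"
    have "2 * card (below ?c A) < card A"
      using card_below_light_move[of A True ?y] Suc.prems True by (simp add: move_def)
    then have "card (below ?c A) < 2 ^ n" using Suc.prems by simp
    then obtain e where e: "e \<in> cert True n (below ?c A)" "e \<in> cert False n (below ?c B)"
      using Suc.IH[of "below ?c A" "below ?c B"] finite_below[OF Suc.prems(1)] by blast
    have "apsnd ((#) ?c) e \<in> cert True (Suc n) A"
      using True e(1) by (auto simp: move_def intro!: bexI[of _ e] exI[of _ ?y])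
    moreover have "apsnd ((#) ?c) e \<in> cert False (Suc n) B"
      using True e(2) by (auto simp: move_def intro!: bexI[of _ e] exI[of _ ?x])
    ultimately show ?thesis by blast
  \<comment> \<open>If the root survives for one player, that player's certificate contains the own
    root cell, and the opponent's certificate always contains this cell.\<close>
  qed auto
qed

lemma sqrt_add_le: "sqrt x + sqrt y \<le> sqrt (2 * (x + y))" if "x \<ge> 0" "y \<ge> 0"
proof (rule real_le_rsqrt)
  have "(sqrt x + sqrt y)\<^sup>2 + (sqrt x - sqrt y)\<^sup>2 = 2 * (x + y)"
    using that by (simp add: power2_sum power2_diff)
  then show "(sqrt x + sqrt y)\<^sup>2 \<le> 2 * (x + y)"
    by (smt (verit) zero_le_power2)
qed

text \<open>The deletions under the two answers together are fewer than half of
  \<open>card A\<close>, so by \<open>sqrt_add_le\<close> the sum of the square roots does not grow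
  from one level to the next. Each level then adds at most \<open>3\<close>, which
  \<open>4 * sqrt (card A)\<close> absorbs because a deleted root makes \<open>A\<close>
  nonempty.\<close>

lemma card_cert:
  assumes "finite A"
  shows "real (card (cert s n A)) \<le> 2 + 4 * real n * sqrt (card A)"
  using assms
proof (induction n arbitrary: A)
  case 0
  then show ?case by (simp add: card_insert_if)
next
  case (Suc n)
  show ?case
  proof (cases "[] \<in> A")
    case True
    let ?x = "light_move s A"
    let ?B = "\<lambda>y. below (move s ?x y) A"
    have "card (cert s (Suc n) A) \<le> Suc (card (\<Union>y. apsnd ((#) (move s ?x y)) ` cert s n (?B y)))"
      using True by (simp add: card_insert_le_m1 card_insert_if cert_finite)
    also have "\<dots> \<le> Suc (\<Sum>y\<in>UNIV. card (apsnd ((#) (move s ?x y)) ` cert s n (?B y)))"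
      using card_UN_le[of UNIV "\<lambda>y. apsnd ((#) (move s ?x y)) ` cert s n (?B y)"] by simp
    also have "\<dots> \<le> Suc (\<Sum>y\<in>UNIV. card (cert s n (?B y)))"
      by (intro Suc_le_mono[THEN iffD2] sum_mono card_image_le cert_finite)
    finally have "real (card (cert s (Suc n) A)) \<le> 1 + (\<Sum>y\<in>UNIV. real (card (cert s n (?B y))))"
      by (metis of_nat_Suc of_nat_le_iff of_nat_sum add.commute)
    also have "\<dots> \<le> 1 + (\<Sum>y\<in>UNIV. 2 + 4 * real n * sqrt (card (?B y)))"
      by (intro add_left_mono sum_mono Suc.IH finite_below Suc.prems)
    also have "\<dots> = 5 + 4 * real n * (sqrt (card (?B True)) + sqrt (card (?B False)))"
      by (simp add: UNIV_bool algebra_simps)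
    also have "\<dots> \<le> 5 + 4 * real n * sqrt (card A)"
    proof -
      have "2 * (card (?B True) + card (?B False)) < card A"
        using load_light_move[OF Suc.prems True, of s] by (simp add: load_def UNIV_bool add.commute)
      then have "real (2 * (card (?B True) + card (?B False))) \<le> real (card A)"
        by (simp only: of_nat_le_iff less_imp_le)
      then have "sqrt (2 * (real (card (?B True)) + card (?B False))) \<le> sqrt (card A)"
        by (intro real_sqrt_le_mono) simp
      then have "sqrt (card (?B True)) + sqrt (card (?B False)) \<le> sqrt (card A)"
        by (rule order_trans[OF sqrt_add_le, rotated 2]) simp_all
      then show ?thesis by (intro add_left_mono mult_left_mono) auto
    qed
    also have "\<dots> \<le> 2 + 4 * real (Suc n) * sqrt (card A)"
    proof -
      have "card A \<ge> 1" using True Suc.prems by (metis One_nat_def Suc_leI card_gt_0_iff empty_iff)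
      then have "1 \<le> sqrt (card A)" by simp
      then have "3 \<le> 4 * sqrt (card A)" by linarith
      then show ?thesis by (simp add: algebra_simps)
    qed
    finally show ?thesis .
  qed (simp add: card_insert_if)
qed

section \<open>Spread weights and random words\<close>

lemma exp_le_quadratic:
  fixes t :: real
  assumes "\<bar>t\<bar> \<le> 1"
  shows "exp t \<le> 1 + t + t\<^sup>2"
proof (cases "t \<ge> 0")
  case True
  then show ?thesis using assms exp_bound[of t] by simp
next
  case False
  define s where "s = - t"
  have s: "s > 0" using False by (simp add: s_def)
  have "exp t = 1 / exp s" by (simp add: s_def exp_minus field_simps)
  also have "\<dots> \<le> 1 / (1 + s)"
    using s exp_ge_add_one_self[of s] by (intro divide_left_mono) (auto intro: mult_pos_pos)
  also have "\<dots> \<le> 1 - s + s\<^sup>2"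
  proof -
    have "(1 - s + s\<^sup>2) * (1 + s) = 1 + s ^ 3" by (simp add: algebra_simps power2_eq_square power3_eq_cube)
    then have "1 \<le> (1 - s + s\<^sup>2) * (1 + s)" using s by simp
    then show ?thesis using s by (simp add: divide_le_eq)
  qed
  finally show ?thesis by (simp add: s_def)
qed

definition words :: "nat \<Rightarrow> nat \<Rightarrow> (nat \<Rightarrow> nat) set" where
  "words m q = ({..<m} \<rightarrow>\<^sub>E {..<q})"

lemma finite_words: "finite (words m q)"
  unfolding words_def by (intro finite_PiE) auto

lemma card_words: "card (words m q) = q ^ m"
  unfolding words_def by (simp add: card_PiE)

definition hits :: "nat \<Rightarrow> nat \<Rightarrow> (nat \<Rightarrow> real) \<Rightarrow> (nat \<Rightarrow> nat) \<Rightarrow> real" where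
  "hits m v c y = (\<Sum>a<m. if y a = v then c a else 0)"

lemma exponential_moment:
  assumes q: "v < q" and c: "\<And>a. a < m \<Longrightarrow> 0 \<le> c a \<and> c a \<le> M" and l: "\<bar>l\<bar> * M \<le> 1"
  shows "(\<Sum>y\<in>words m q. exp (l * hits m v c y))
    \<le> real q ^ m * exp ((l + l\<^sup>2 * M) * (\<Sum>a<m. c a) / q)"
proof -
  have "exp (l * hits m v c y) = (\<Prod>a<m. exp (l * (if y a = v then c a else 0)))" for y
    unfolding hits_def by (simp add: sum_distrib_left exp_sum)
  then have "(\<Sum>y\<in>words m q. exp (l * hits m v c y))
      = (\<Prod>a<m. \<Sum>u<q. exp (l * (if u = v then c a else 0)))"
    unfolding words_def by (simp add: prod_sum_PiE)
  also have "\<dots> \<le> (\<Prod>a<m. real q * exp ((l + l\<^sup>2 * M) * c a / q))"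
  proof (rule prod_mono, intro conjI)
    fix a assume a: "a \<in> {..<m}"
    let ?t = "l * c a"
    have t: "\<bar>?t\<bar> \<le> 1"
    proof -
      have "\<bar>?t\<bar> = \<bar>l\<bar> * c a" using c[of a] a by (simp add: abs_mult)
      also have "\<dots> \<le> \<bar>l\<bar> * M" using c[of a] a by (intro mult_left_mono) auto
      finally show ?thesis using l by simp
    qed
    have "(\<Sum>u<q. exp (l * (if u = v then c a else 0))) = (\<Sum>u<q. 1 + (if u = v then exp ?t - 1 else 0))"
      by (intro sum.cong) auto
    also have "\<dots> = real q + (exp ?t - 1)"
      using q by (simp add: sum.distrib)
    also have "\<dots> \<le> real q + (?t + ?t\<^sup>2)"
      using exp_le_quadratic[OF t] by simp
    also have "\<dots> \<le> real q + (l + l\<^sup>2 * M) * c a"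
    proof -
      have "?t\<^sup>2 = l\<^sup>2 * (c a * c a)" by (simp add: power2_eq_square)
      also have "\<dots> \<le> l\<^sup>2 * (M * c a)" using c[of a] a by (intro mult_left_mono mult_right_mono) auto
      finally show ?thesis by (simp add: algebra_simps)
    qed
    also have "\<dots> = real q * (1 + (l + l\<^sup>2 * M) * c a / q)"
      using q by (simp add: field_simps)
    also have "\<dots> \<le> real q * exp ((l + l\<^sup>2 * M) * c a / q)"
      by (intro mult_left_mono exp_ge_add_one_self) auto
    finally show "(\<Sum>u<q. exp (l * (if u = v then c a else 0))) \<le> real q * exp ((l + l\<^sup>2 * M) * c a / q)" .
  qed (auto intro: sum_nonneg)
  also have "\<dots> = real q ^ m * exp ((l + l\<^sup>2 * M) * (\<Sum>a<m. c a) / q)"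
    by (simp add: prod.distrib exp_sum[symmetric] sum_divide_distrib sum_distrib_left)
  finally show ?thesis .
qed

lemma upper_tail:
  assumes q: "v < q" and c: "\<And>a. a < m \<Longrightarrow> 0 \<le> c a \<and> c a \<le> M" and s: "(\<Sum>a<m. c a) \<le> s"
    and M: "M > 0" and e: "0 < e" "e \<le> 1"
  shows "real (card {y \<in> words m q. hits m v c y > (1 + e) * s / q}) \<le> real q ^ m * exp (- e\<^sup>2 * s / (4 * M * q))"
proof -
  \<comment> \<open>This \<open>l\<close> minimises \<open>l\<^sup>2 * M - l * e\<close>, which is
    the final exponent up to the factor \<open>s / q\<close>.\<close>
  define l where "l = e / (2 * M)"
  have l: "l > 0" "l * M = e / 2" using e M by (auto simp: l_def)
  let ?B = "{y \<in> words m q. hits m v c y > (1 + e) * s / q}"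
  have "real (card ?B) * exp (l * ((1 + e) * s / q)) = (\<Sum>y\<in>?B. exp (l * ((1 + e) * s / q)))" by simp
  also have "\<dots> \<le> (\<Sum>y\<in>?B. exp (l * hits m v c y))"
    using l by (intro sum_mono) (auto intro!: mult_left_mono simp del: times_divide_eq_right)
  also have "\<dots> \<le> (\<Sum>y\<in>words m q. exp (l * hits m v c y))"
    by (intro sum_mono2) (auto intro: finite_words)
  also have "\<dots> \<le> real q ^ m * exp ((l + l\<^sup>2 * M) * (\<Sum>a<m. c a) / q)"
    using l e by (intro exponential_moment q c) auto
  also have "\<dots> \<le> real q ^ m * exp ((l + l\<^sup>2 * M) * s / q)"
    using s l M by (intro mult_left_mono) (auto intro!: divide_right_mono mult_left_mono add_nonneg_nonneg)
  finally have "real (card ?B) \<le> real q ^ m * exp ((l + l\<^sup>2 * M) * s / q) / exp (l * ((1 + e) * s / q))"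
    by (simp add: pos_le_divide_eq)
  also have "\<dots> = real q ^ m * exp ((l + l\<^sup>2 * M) * s / q - l * ((1 + e) * s / q))"
    by (simp add: exp_diff)
  also have "(l + l\<^sup>2 * M) * s / q - l * ((1 + e) * s / q) = - e\<^sup>2 * s / (4 * M * q)"
    using M q by (simp add: l_def field_simps power2_eq_square)
  finally show ?thesis .
qed

lemma lower_tail:
  assumes q: "v < q" and c: "\<And>a. a < m \<Longrightarrow> 0 \<le> c a \<and> c a \<le> M" and s: "s \<le> (\<Sum>a<m. c a)"
    and M: "M > 0" and e: "0 < e" "e \<le> 1"
  shows "real (card {y \<in> words m q. hits m v c y < (1 - e) * s / q}) \<le> real q ^ m * exp (- e\<^sup>2 * s / (4 * M * q))"
proof -
  define l where "l = e / (2 * M)"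
  have l: "l > 0" "l * M = e / 2" using e M by (auto simp: l_def)
  let ?B = "{y \<in> words m q. hits m v c y < (1 - e) * s / q}"
  have "real (card ?B) * exp (- l * ((1 - e) * s / q)) = (\<Sum>y\<in>?B. exp (- l * ((1 - e) * s / q)))" by simp
  also have "\<dots> \<le> (\<Sum>y\<in>?B. exp (- l * hits m v c y))"
    using l by (intro sum_mono) (auto intro!: mult_left_mono simp del: times_divide_eq_right)
  also have "\<dots> \<le> (\<Sum>y\<in>words m q. exp (- l * hits m v c y))"
    by (intro sum_mono2) (auto intro: finite_words)
  also have "\<dots> \<le> real q ^ m * exp ((- l + (- l)\<^sup>2 * M) * (\<Sum>a<m. c a) / q)"
    using l e by (intro exponential_moment q c) auto
  also have "\<dots> \<le> real q ^ m * exp ((- l + l\<^sup>2 * M) * s / q)"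
  proof -
    \<comment> \<open>The coefficient is negative, so here a lower bound on the total weight is what
      bounds the exponent from above.\<close>
    have "- l + l\<^sup>2 * M = - (l * (1 - e / 2))" using l by (simp add: power2_eq_square algebra_simps)
    moreover have "l * (1 - e / 2) * s \<le> l * (1 - e / 2) * (\<Sum>a<m. c a)"
      using l e s by (intro mult_left_mono) auto
    ultimately show ?thesis
      by (intro mult_left_mono) (auto intro!: divide_right_mono)
  qed
  finally have "real (card ?B) \<le> real q ^ m * exp ((- l + l\<^sup>2 * M) * s / q) / exp (- l * ((1 - e) * s / q))"
    by (simp add: pos_le_divide_eq)
  also have "\<dots> = real q ^ m * exp ((- l + l\<^sup>2 * M) * s / q - (- l * ((1 - e) * s / q)))"
    by (simp only: exp_diff times_divide_eq_right)
  also have "(- l + l\<^sup>2 * M) * s / q - (- l * ((1 - e) * s / q)) = - e\<^sup>2 * s / (4 * M * q)"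
    using M q by (simp add: l_def field_simps power2_eq_square)
  finally show ?thesis .
qed

text \<open>A blockwise min-entropy condition for an unnormalised weight: \<open>A\<close> bounds
  the total weight, by the case of empty \<open>J\<close>, and every further fixed coordinate must
  lower the bound by a factor \<open>k\<close>.\<close>

definition spread :: "'i set \<Rightarrow> nat \<Rightarrow> ('i \<Rightarrow> nat) set \<Rightarrow> (('i \<Rightarrow> nat) \<Rightarrow> real) \<Rightarrow> real \<Rightarrow> real \<Rightarrow> bool" where
  "spread D m X w k A \<longleftrightarrow> (\<forall>J\<subseteq>D. \<forall>b\<in>J \<rightarrow>\<^sub>E {..<m}.
     (\<Sum>x\<in>{x\<in>X. \<forall>j\<in>J. x j = b j}. w x) \<le> A / k ^ card J)"

lemma spreadD:
  "spread D m X w k A \<Longrightarrow> J \<subseteq> D \<Longrightarrow> b \<in> J \<rightarrow>\<^sub>E {..<m} \<Longrightarrow>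
    (\<Sum>x\<in>{x\<in>X. \<forall>j\<in>J. x j = b j}. w x) \<le> A / k ^ card J"
  unfolding spread_def by blast

definition missed :: "'i set \<Rightarrow> nat \<Rightarrow> nat \<Rightarrow> ('i \<Rightarrow> nat) set \<Rightarrow> ('i \<Rightarrow> nat) \<Rightarrow> ('i \<Rightarrow> nat \<Rightarrow> nat) set" where
  "missed D m q X v = {y \<in> D \<rightarrow>\<^sub>E words m q. \<not> (\<exists>x\<in>X. \<forall>i\<in>D. y i (x i) = v i)}"

lemma finite_missed: "finite D \<Longrightarrow> finite (missed D m q X v)"
  unfolding missed_def by (intro finite_subset[OF _ finite_PiE[of D "\<lambda>_. words m q"]]) (auto intro: finite_words)

text \<open>Splits off the word at coordinate \<open>i\<close>: a word in \<open>G\<close> is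
  charged with all completions, any other word only with the completions missed by the rows that it
  leaves.\<close>

lemma card_missed_insert:
  assumes D: "finite D" "i \<notin> D" and G: "G \<subseteq> words m q"
    and bnd: "\<And>f. f \<in> words m q - G \<Longrightarrow> real (card (missed D m q {x\<in>X. f (x i) = v i} v)) \<le> K"
    and K: "K \<ge> 0"
  shows "real (card (missed (insert i D) m q X v)) \<le> real (card G) * real (q ^ m) ^ card D + real q ^ m * K"
proof -
  let ?M = "missed (insert i D) m q X v"
  let ?S = "(SIGMA f:words m q. if f \<in> G then D \<rightarrow>\<^sub>E words m q else missed D m q {x\<in>X. f (x i) = v i} v)"
  have fin: "finite ?S"
    using D by (intro finite_SigmaI) (auto intro: finite_words finite_PiE finite_missed)
  have "inj_on (\<lambda>y. (y i, restrict y D)) ?M"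
  proof (rule inj_onI)
    fix y y' assume "y \<in> ?M" "y' \<in> ?M" and e: "(y i, restrict y D) = (y' i, restrict y' D)"
    then have ext: "y \<in> extensional (insert i D)" "y' \<in> extensional (insert i D)"
      by (auto simp: missed_def PiE_def)
    show "y = y'"
    proof (rule extensionalityI[OF ext])
      fix j assume "j \<in> insert i D"
      then show "y j = y' j" using e by (metis Pair_inject insert_iff restrict_apply')
    qed
  qed
  moreover have "(\<lambda>y. (y i, restrict y D)) ` ?M \<subseteq> ?S"
    by (auto simp: missed_def PiE_iff)
  ultimately have "card ?M \<le> card ?S" using fin by (rule card_inj_on_le)
  also have "card ?S = (\<Sum>f\<in>words m q. card (if f \<in> G then D \<rightarrow>\<^sub>E words m q else missed D m q {x\<in>X. f (x i) = v i} v))"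
    using D by (intro card_SigmaI) (auto intro: finite_words finite_PiE finite_missed)
  also have "real \<dots> = (\<Sum>f\<in>words m q. real (card (if f \<in> G then D \<rightarrow>\<^sub>E words m q else missed D m q {x\<in>X. f (x i) = v i} v)))"
    by simp
  also have "\<dots> \<le> (\<Sum>f\<in>words m q. (if f \<in> G then real (q ^ m) ^ card D else 0) + K)"
    using D bnd K by (intro sum_mono) (auto simp: card_PiE card_words)
  also have "\<dots> = real (card G) * real (q ^ m) ^ card D + real q ^ m * K"
    using G by (simp add: sum.distrib card_words sum.If_cases finite_words Int_absorb1)
  finally show ?thesis by simp
qed

text \<open>Expresses the weight of the rows that survive reading a word as a letter count, to which
  the tail bounds apply.\<close>

lemma sum_fibres:
  fixes w :: "('i \<Rightarrow> nat) \<Rightarrow> real"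
  assumes "finite X" "\<And>x. x \<in> X \<Longrightarrow> x i < m"
  shows "hits m v (\<lambda>a. \<Sum>x\<in>{x\<in>X. P x \<and> x i = a}. w x) y = (\<Sum>x\<in>{x\<in>X. P x \<and> y (x i) = v}. w x)"
    and "(\<Sum>a<m. \<Sum>x\<in>{x\<in>X. P x \<and> x i = a}. w x) = (\<Sum>x\<in>{x\<in>X. P x}. w x)"
proof -
  have *: "(\<Sum>a<m. \<Sum>x\<in>{x\<in>X. Q x \<and> x i = a}. w x) = (\<Sum>x\<in>{x\<in>X. Q x}. w x)" for Q
  proof -
    have "(\<Sum>a<m. \<Sum>x\<in>{x\<in>X. Q x \<and> x i = a}. w x) = (\<Sum>a<m. \<Sum>x\<in>{x\<in>{x\<in>X. Q x}. x i = a}. w x)"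
      by (intro sum.cong) auto
    also have "\<dots> = (\<Sum>x\<in>{x\<in>X. Q x}. w x)"
      using assms by (intro sum.group) auto
    finally show ?thesis .
  qed
  show "(\<Sum>a<m. \<Sum>x\<in>{x\<in>X. P x \<and> x i = a}. w x) = (\<Sum>x\<in>{x\<in>X. P x}. w x)" by (rule *)
  have "hits m v (\<lambda>a. \<Sum>x\<in>{x\<in>X. P x \<and> x i = a}. w x) y
      = (\<Sum>a<m. \<Sum>x\<in>{x\<in>X. (P x \<and> y (x i) = v) \<and> x i = a}. w x)"
    unfolding hits_def
  proof (rule sum.cong[OF refl])
    fix a
    have "{x\<in>X. (P x \<and> y (x i) = v) \<and> x i = a} = (if y a = v then {x\<in>X. P x \<and> x i = a} else {})"
      by auto
    then show "(if y a = v then \<Sum>x\<in>{x\<in>X. P x \<and> x i = a}. w x else 0)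
        = (\<Sum>x\<in>{x\<in>X. (P x \<and> y (x i) = v) \<and> x i = a}. w x)"
      by simp
  qed
  then show "hits m v (\<lambda>a. \<Sum>x\<in>{x\<in>X. P x \<and> x i = a}. w x) y = (\<Sum>x\<in>{x\<in>X. P x \<and> y (x i) = v}. w x)"
    using *[of "\<lambda>x. P x \<and> y (x i) = v"] by simp
qed

text \<open>Reading a random word at coordinate \<open>i\<close> divides all subcube weights by about \<open>q\<close>, so
  spreadness survives; this fails only with exponentially small probability.\<close>
lemma card_not_spread:
  assumes D: "finite D" "i \<notin> D" and X: "finite X" "\<And>x. x \<in> X \<Longrightarrow> x i < m"
    and w: "\<And>x. x \<in> X \<Longrightarrow> w x \<ge> 0"
    and sp: "spread (insert i D) m X w k A" and A: "A > 0" and k: "k > 0" and m: "m \<ge> 1"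
    and v: "v i < q" and e: "0 < e" "e \<le> 1"
  shows "real (card {f \<in> words m q. \<not> spread D m {x\<in>X. f (x i) = v i} w k ((1 + e) * A / q)})
    \<le> (2 * real m) ^ card D * (real q ^ m * exp (- e\<^sup>2 * k / (4 * real q)))"
proof -
  let ?I = "SIGMA J:Pow D. J \<rightarrow>\<^sub>E {..<m}"
  let ?c = "\<lambda>J b a. \<Sum>x\<in>{x\<in>X. (\<forall>j\<in>J. x j = b j) \<and> x i = a}. w x"
  let ?E = "\<lambda>(J, b). {f \<in> words m q. hits m (v i) (?c J b) f > (1 + e) * (A / k ^ card J) / q}"
  have finI: "finite ?I" using D by (intro finite_SigmaI) (auto intro: finite_PiE finite_subset)
  have "{f \<in> words m q. \<not> spread D m {x\<in>X. f (x i) = v i} w k ((1 + e) * A / q)} \<subseteq> (\<Union>Jb\<in>?I. ?E Jb)"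
  proof
    fix f assume f: "f \<in> {f \<in> words m q. \<not> spread D m {x\<in>X. f (x i) = v i} w k ((1 + e) * A / q)}"
    then obtain J b where J: "J \<subseteq> D" "b \<in> J \<rightarrow>\<^sub>E {..<m}"
      and "\<not> (\<Sum>x\<in>{x\<in>{x\<in>X. f (x i) = v i}. \<forall>j\<in>J. x j = b j}. w x) \<le> (1 + e) * A / q / k ^ card J"
      unfolding spread_def by blast
    moreover have "{x\<in>{x\<in>X. f (x i) = v i}. \<forall>j\<in>J. x j = b j} = {x\<in>X. (\<forall>j\<in>J. x j = b j) \<and> f (x i) = v i}"
      by auto
    moreover have "hits m (v i) (?c J b) f = (\<Sum>x\<in>{x\<in>X. (\<forall>j\<in>J. x j = b j) \<and> f (x i) = v i}. w x)"
      by (rule sum_fibres(1)) (use X in auto)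
    ultimately have "hits m (v i) (?c J b) f > (1 + e) * (A / k ^ card J) / q"
      by (simp add: field_simps)
    then show "f \<in> (\<Union>Jb\<in>?I. ?E Jb)" using J f by (intro UN_I[of "(J, b)"]) auto
  qed
  then have "card {f \<in> words m q. \<not> spread D m {x\<in>X. f (x i) = v i} w k ((1 + e) * A / q)} \<le> card (\<Union>Jb\<in>?I. ?E Jb)"
    using finI by (intro card_mono finite_UN_I) (auto simp: finite_words)
  also have "\<dots> \<le> (\<Sum>Jb\<in>?I. card (?E Jb))" by (rule card_UN_le[OF finI])
  also have "real \<dots> = (\<Sum>Jb\<in>?I. real (card (?E Jb)))" by simp
  also have "\<dots> \<le> (\<Sum>Jb\<in>?I. real q ^ m * exp (- e\<^sup>2 * k / (4 * real q)))"
  proof (rule sum_mono)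
    fix Jb assume "Jb \<in> ?I"
    then obtain J b where Jb: "Jb = (J, b)" "J \<subseteq> D" "b \<in> J \<rightarrow>\<^sub>E {..<m}" by auto
    have iJ: "i \<notin> J" "finite J" using Jb D finite_subset by auto
    have "(\<Sum>a<m. ?c J b a) = (\<Sum>x\<in>{x\<in>X. \<forall>j\<in>J. x j = b j}. w x)"
      by (rule sum_fibres(2)[OF X])
    also have "\<dots> \<le> A / k ^ card J"
      using sp Jb unfolding spread_def by blast
    finally have s: "(\<Sum>a<m. ?c J b a) \<le> A / k ^ card J" .
    \<comment> \<open>Spreadness on \<open>insert i J\<close> caps every single weight at a
      \<open>1 / k\<close> fraction of the bound on their total, whatever the size of
      \<open>J\<close>. Hence the same tail bound serves all subcubes.\<close>
    have c: "0 \<le> ?c J b a \<and> ?c J b a \<le> A / k ^ Suc (card J)" if "a < m" for a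
    proof
      show "0 \<le> ?c J b a" using w by (intro sum_nonneg) auto
      have "{x\<in>X. (\<forall>j\<in>J. x j = b j) \<and> x i = a} = {x\<in>X. \<forall>j\<in>insert i J. x j = (b(i := a)) j}"
        using iJ by auto
      moreover have "b(i := a) \<in> insert i J \<rightarrow>\<^sub>E {..<m}"
        using Jb that by (intro PiE_fun_upd) auto
      moreover have "insert i J \<subseteq> insert i D" using Jb by auto
      ultimately have "?c J b a \<le> A / k ^ card (insert i J)"
        using spreadD[OF sp, of "insert i J" "b(i := a)"] by simp
      then show "?c J b a \<le> A / k ^ Suc (card J)" using iJ by simp
    qed
    have "real (card (?E Jb)) \<le> real q ^ m * exp (- e\<^sup>2 * (A / k ^ card J) / (4 * (A / k ^ Suc (card J)) * q))"
      unfolding Jb(1) prod.case using v c s A k e by (intro upper_tail) auto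
    also have "- e\<^sup>2 * (A / k ^ card J) / (4 * (A / k ^ Suc (card J)) * q) = - e\<^sup>2 * k / (4 * real q)"
      using A k by (simp add: field_simps)
    finally show "real (card (?E Jb)) \<le> real q ^ m * exp (- e\<^sup>2 * k / (4 * real q))" .
  qed
  also have "\<dots> = real (card ?I) * (real q ^ m * exp (- e\<^sup>2 * k / (4 * real q)))" by simp
  also have "\<dots> \<le> (2 * real m) ^ card D * (real q ^ m * exp (- e\<^sup>2 * k / (4 * real q)))"
  proof (rule mult_right_mono)
    have "card ?I = (\<Sum>J\<in>Pow D. card (J \<rightarrow>\<^sub>E {..<m}))"
      using D by (intro card_SigmaI) (auto intro: finite_PiE finite_subset)
    also have "\<dots> \<le> (\<Sum>J\<in>Pow D. m ^ card D)"
    proof (rule sum_mono)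
      fix J assume "J \<in> Pow D"
      then have "finite J" "card J \<le> card D" using D by (auto intro: finite_subset card_mono)
      then show "card (J \<rightarrow>\<^sub>E {..<m}) \<le> m ^ card D" using m by (simp add: card_PiE power_increasing)
    qed
    also have "\<dots> = (2 * m) ^ card D" using D by (simp add: card_Pow power_mult_distrib)
    finally have "real (card ?I) \<le> real ((2 * m) ^ card D)" by (simp only: of_nat_le_iff)
    then show "real (card ?I) \<le> (2 * real m) ^ card D" by simp
  qed auto
  finally show ?thesis by simp
qed

text \<open>The coordinates are read one by one, with \<open>A\<close> and \<open>B\<close> bounding
  the surviving weight from above and below. The ratio of the bounds grows by at most
  \<open>(1 + e) / (1 - e) \<le> 1 + 4 * e\<close> per coordinate, so the slack \<open>8\<close>
  lasts to the end. There \<open>B > 0\<close> leaves some row and nothing is missed; the bound adds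
  up the failures of the single readings.\<close>

lemma card_missed:
  assumes D: "finite D" and X: "finite X" "\<And>x i. x \<in> X \<Longrightarrow> i \<in> D \<Longrightarrow> x i < m"
    and w: "\<And>x. x \<in> X \<Longrightarrow> w x \<ge> 0"
    and sp: "spread D m X w k A" and B: "B > 0" "B \<le> (\<Sum>x\<in>X. w x)"
    and AB: "A * (1 + 4 * e) ^ card D \<le> 8 * B"
    and k: "k > 0" and m: "m \<ge> 1" and v: "\<And>i. i \<in> D \<Longrightarrow> v i < q" and e: "0 < e" "e \<le> 1 / 2"
  shows "real (card (missed D m q X v))
    \<le> real (q ^ m) ^ card D * (card D * ((2 * real m) ^ card D + 1) * exp (- e\<^sup>2 * k / (32 * real q)))"
  using D X w sp B AB v
proof (induction D arbitrary: X A B rule: finite_induct)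
  case empty
  then have "X \<noteq> {}" by auto
  then have "missed {} m q X v = {}" by (auto simp: missed_def)
  then show ?case by simp
next
  case (insert i D)
  let ?r = "\<lambda>f. {x\<in>X. f (x i) = v i}"
  \<comment> \<open>A word fails if the surviving rows are no longer spread (\<open>?G1\<close>) or
    carry too little weight (\<open>?G2\<close>).\<close>
  let ?G1 = "{f \<in> words m q. \<not> spread D m (?r f) w k ((1 + e) * A / q)}"
  let ?c = "\<lambda>a. \<Sum>x\<in>{x\<in>X. True \<and> x i = a}. w x"
  let ?G2 = "{f \<in> words m q. hits m (v i) ?c f < (1 - e) * B / q}"
  let ?x = "exp (- e\<^sup>2 * k / (32 * real q))"
  let ?d = "card D"
  have q: "q > 0" using insert.prems(8)[of i] by auto
  have total: "(\<Sum>x\<in>X. w x) \<le> A"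
    using insert.prems(4) unfolding spread_def by (auto dest!: spec[of _ "{}"])
  have A: "A > 0" "B \<le> A" using total insert.prems(5,6) by auto
  have A8: "A \<le> 8 * B"
  proof -
    have "A * 1 \<le> A * (1 + 4 * e) ^ card (insert i D)"
      using A e by (intro mult_left_mono one_le_power) auto
    then show ?thesis using insert.prems(7) by simp
  qed
  have x4: "exp (- e\<^sup>2 * k / (4 * real q)) \<le> ?x"
    using q k by (auto simp: field_simps)
  have "real (card ?G1) \<le> (2 * real m) ^ ?d * (real q ^ m * exp (- e\<^sup>2 * k / (4 * real q)))"
    using insert.hyps insert.prems A k m e by (intro card_not_spread) auto
  also have "\<dots> \<le> (2 * real m) ^ ?d * (real q ^ m * ?x)"
    using x4 by (intro mult_left_mono) auto
  finally have G1: "real (card ?G1) \<le> (2 * real m) ^ ?d * (real q ^ m * ?x)" .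
  have G2: "real (card ?G2) \<le> real q ^ m * ?x"
  proof -
    have c: "0 \<le> ?c a \<and> ?c a \<le> A / k" if "a < m" for a
    proof
      show "0 \<le> ?c a" using insert.prems(3) by (intro sum_nonneg) auto
      have "(\<lambda>j\<in>{i}. a) \<in> {i} \<rightarrow>\<^sub>E {..<m}"
        using that by (intro restrict_PiE_iff[THEN iffD2]) simp
      then have "(\<Sum>x\<in>{x\<in>X. \<forall>j\<in>{i}. x j = (\<lambda>j\<in>{i}. a) j}. w x) \<le> A / k ^ card {i}"
        by (rule spreadD[OF insert.prems(4), rotated]) simp
      then show "?c a \<le> A / k" by simp
    qed
    have "B \<le> (\<Sum>a<m. ?c a)"
    proof -
      have "(\<Sum>a<m. ?c a) = (\<Sum>x\<in>{x\<in>X. True}. w x)"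
        by (rule sum_fibres(2)) (use insert.prems(1,2) in auto)
      then show ?thesis using insert.prems(6) by simp
    qed
    then have "real (card ?G2) \<le> real q ^ m * exp (- e\<^sup>2 * B / (4 * (A / k) * q))"
      using insert.prems(8) c A k e by (intro lower_tail) auto
    also have "\<dots> \<le> real q ^ m * ?x"
    proof -
      \<comment> \<open>The ratio bound \<open>A \<le> 8 * B\<close> turns the constant
        \<open>4\<close> of the tail bound into \<open>32\<close>.\<close>
      have "e\<^sup>2 * k / (32 * real q) \<le> e\<^sup>2 * B / (4 * (A / k) * q)"
      proof -
        have "(e\<^sup>2 * k / (4 * real q)) * (1 / 8) \<le> (e\<^sup>2 * k / (4 * real q)) * (B / A)"
          using A8 A k by (intro mult_left_mono) (auto simp: field_simps)
        then show ?thesis using A k by (simp add: field_simps)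
      qed
      then show ?thesis by (intro mult_left_mono) auto
    qed
    finally show ?thesis .
  qed
  let ?K = "real (q ^ m) ^ ?d * (?d * ((2 * real m) ^ ?d + 1) * ?x)"
  have step: "real (card (missed D m q (?r f) v)) \<le> ?K" if f: "f \<in> words m q - (?G1 \<union> ?G2)" for f
  proof (rule insert.IH[where A = "(1 + e) * A / q" and B = "(1 - e) * B / q"])
    show "spread D m (?r f) w k ((1 + e) * A / q)" using f by auto
    show "0 < (1 - e) * B / q" using e insert.prems(5) q by auto
    show "(1 - e) * B / q \<le> (\<Sum>x\<in>?r f. w x)"
    proof -
      have "hits m (v i) ?c f = (\<Sum>x\<in>{x\<in>X. True \<and> f (x i) = v i}. w x)"
        by (rule sum_fibres(1)) (use insert.prems(1,2) in auto)
      then show ?thesis using f by auto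
    qed
    have "(1 + e) \<le> (1 - e) * (1 + 4 * e)"
    proof -
      have "e * e \<le> e * (1 / 2)" using e by (intro mult_left_mono) auto
      then show ?thesis by (simp add: algebra_simps)
    qed
    then have "(1 + e) * (A * (1 + 4 * e) ^ ?d) \<le> (1 - e) * (1 + 4 * e) * (A * (1 + 4 * e) ^ ?d)"
      using A e by (intro mult_right_mono) auto
    also have "\<dots> = (1 - e) * (A * (1 + 4 * e) ^ card (insert i D))"
      using insert.hyps by simp
    also have "\<dots> \<le> (1 - e) * (8 * B)"
      using insert.prems(7) e by (intro mult_left_mono) auto
    finally have "(1 + e) * (A * (1 + 4 * e) ^ ?d) / q \<le> (1 - e) * (8 * B) / q"
      by (rule divide_right_mono) simp
    then show "(1 + e) * A / q * (1 + 4 * e) ^ ?d \<le> 8 * ((1 - e) * B / q)"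
      by (simp add: algebra_simps)
  qed (use insert.prems in auto)
  have "real (card (missed (insert i D) m q X v))
      \<le> real (card (?G1 \<union> ?G2)) * real (q ^ m) ^ ?d + real q ^ m * ?K"
    using insert.hyps step by (intro card_missed_insert) auto
  also have "\<dots> \<le> ((2 * real m) ^ ?d * (real q ^ m * ?x) + real q ^ m * ?x) * real (q ^ m) ^ ?d + real q ^ m * ?K"
    using G1 G2 card_Un_le[of ?G1 ?G2] by (intro add_right_mono mult_right_mono) auto
  also have "\<dots> = real (q ^ m) ^ Suc ?d * (Suc ?d * ((2 * real m) ^ ?d + 1) * ?x)"
    by (simp add: algebra_simps)
  also have "\<dots> \<le> real (q ^ m) ^ Suc ?d * (Suc ?d * ((2 * real m) ^ Suc ?d + 1) * ?x)"
    using m by (intro mult_left_mono mult_right_mono add_right_mono power_increasing) auto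
  finally show ?case using insert.hyps by simp
qed

section \<open>Rectangles of zeros of a lifted unambiguous DNF\<close>

lemma card_PiE_restrict_le:
  assumes "finite I" "D \<subseteq> I" "finite B" "\<And>i. i \<in> I \<Longrightarrow> finite (F i)"
  shows "card {y \<in> Pi\<^sub>E I F. restrict y D \<in> B} \<le> card B * (\<Prod>i\<in>I - D. card (F i))"
proof -
  let ?Y = "{y \<in> Pi\<^sub>E I F. restrict y D \<in> B}"
  have "inj_on (\<lambda>y. (restrict y D, restrict y (I - D))) ?Y"
  proof (rule inj_onI)
    fix y y' assume "y \<in> ?Y" "y' \<in> ?Y"
      and e: "(restrict y D, restrict y (I - D)) = (restrict y' D, restrict y' (I - D))"
    then have ext: "y \<in> extensional I" "y' \<in> extensional I" by (auto simp: PiE_def)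
    show "y = y'"
    proof (rule extensionalityI[OF ext])
      fix i assume "i \<in> I"
      then show "y i = y' i" using e by (cases "i \<in> D") (metis Diff_iff Pair_inject restrict_apply')+
    qed
  qed
  moreover have "(\<lambda>y. (restrict y D, restrict y (I - D))) ` ?Y \<subseteq> B \<times> Pi\<^sub>E (I - D) F"
    by auto
  moreover have "finite (B \<times> Pi\<^sub>E (I - D) F)" using assms by (auto intro: finite_PiE)
  ultimately have "card ?Y \<le> card (B \<times> Pi\<^sub>E (I - D) F)" by (rule card_inj_on_le)
  then show ?thesis using assms by (simp add: card_cartesian_product card_PiE)
qed

lemma card_PiE_fixed:
  assumes "finite I" "S \<subseteq> I" "\<And>i. i \<in> S \<Longrightarrow> a i < m"
  shows "card {x \<in> I \<rightarrow>\<^sub>E {..<m}. \<forall>i\<in>S. x i = a i} = m ^ (card I - card S)"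
proof -
  have "{x \<in> I \<rightarrow>\<^sub>E {..<m}. \<forall>i\<in>S. x i = a i} = (\<Pi>\<^sub>E i\<in>I. if i \<in> S then {a i} else {..<m})"
    using assms by (auto simp: PiE_iff extensional_def split: if_splits)
  then have "card {x \<in> I \<rightarrow>\<^sub>E {..<m}. \<forall>i\<in>S. x i = a i} = (\<Prod>i\<in>I. if i \<in> S then 1 else m)"
    using assms by (simp add: card_PiE if_distrib cong: if_cong)
  also have "\<dots> = m ^ card (I - S)"
    using assms by (simp add: prod.If_cases Diff_eq)
  finally show ?thesis using assms by (simp add: card_Diff_subset finite_subset)
qed

lemma card_words_through:
  assumes "finite I" "\<And>i. i \<in> I \<Longrightarrow> x i < m" "\<And>i. i \<in> I \<Longrightarrow> z i < q"
  shows "card {y \<in> I \<rightarrow>\<^sub>E words m q. \<forall>i\<in>I. y i (x i) = z i} = q ^ ((m - 1) * card I)"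
proof -
  have "{y \<in> I \<rightarrow>\<^sub>E words m q. \<forall>i\<in>I. y i (x i) = z i} = (\<Pi>\<^sub>E i\<in>I. {f \<in> {..<m} \<rightarrow>\<^sub>E {..<q}. \<forall>a\<in>{x i}. f a = z i})"
    by (auto simp: PiE_iff words_def extensional_def)
  also have "card \<dots> = (\<Prod>i\<in>I. q ^ (m - 1))"
  proof -
    have "card {f \<in> {..<m} \<rightarrow>\<^sub>E {..<q}. \<forall>a\<in>{x i}. f a = z i} = q ^ (m - 1)" if "i \<in> I" for i
      using card_PiE_fixed[of "{..<m}" "{x i}" "\<lambda>_. z i" q] assms that by simp
    then show ?thesis using assms(1) by (simp add: card_PiE)
  qed
  finally show ?thesis by (simp add: power_mult)
qed

locale unambiguous_dnf =
  fixes I :: "'i set" and Cs :: "'c set" and dm :: "'c \<Rightarrow> 'i set" and vl :: "'c \<Rightarrow> 'i \<Rightarrow> nat" and q :: nat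
  assumes finite_I: "finite I" and finite_Cs: "finite Cs"
    and dm_subset: "c \<in> Cs \<Longrightarrow> dm c \<subseteq> I"
    and vl_less: "c \<in> Cs \<Longrightarrow> i \<in> dm c \<Longrightarrow> vl c i < q"
    and conflict: "c \<in> Cs \<Longrightarrow> c' \<in> Cs \<Longrightarrow> c \<noteq> c' \<Longrightarrow> \<exists>i\<in>dm c \<inter> dm c'. vl c i \<noteq> vl c' i"
begin

definition sat :: "('i \<Rightarrow> nat) \<Rightarrow> bool" where
  "sat z \<longleftrightarrow> (\<exists>c\<in>Cs. \<forall>i\<in>dm c. z i = vl c i)"

text \<open>That is, no certificate of size at most \<open>C\<close> shows that \<open>z\<close> is falsifying.\<close>
definition robust :: "('i \<Rightarrow> nat) \<Rightarrow> nat \<Rightarrow> bool" where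
  "robust z C \<longleftrightarrow> (\<forall>S\<subseteq>I. card S \<le> C \<longrightarrow> (\<exists>c\<in>Cs. \<forall>i\<in>S \<inter> dm c. z i = vl c i))"

text \<open>Fix the subcube \<open>(S, a)\<close> of rows that maximises the weight times \<open>k ^ card S\<close>. Then \<open>S\<close>
  is so small that some certificate agrees with \<open>z\<close> on \<open>S\<close>, and by maximality the weight is spread
  on the other coordinates, so that almost every column completes this certificate.\<close>
lemma rectangle_bound:
  assumes X: "X \<subseteq> I \<rightarrow>\<^sub>E {..<m}" and Y: "Y \<subseteq> I \<rightarrow>\<^sub>E words m q"
    and unsat: "\<And>x y. x \<in> X \<Longrightarrow> y \<in> Y \<Longrightarrow> \<not> sat (\<lambda>i. y i (x i))"
    and z: "\<And>i. i \<in> I \<Longrightarrow> z i < q" and rob: "robust z C"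
    and w: "\<And>c. c \<in> Cs \<Longrightarrow> card (dm c) \<le> w" "w \<ge> 1"
    and k: "k \<ge> 2" "m = k\<^sup>2" and q: "q \<ge> 1"
    and small: "real w * ((2 * real m) ^ w + 1) * exp (- real k / (512 * (real w)\<^sup>2 * real q))
      * real q ^ card I * real k ^ (2 * C) \<le> 1"
  shows "card {(x, y). x \<in> X \<and> y \<in> Y \<and> (\<forall>i\<in>I. y i (x i) = z i)} * k ^ C
    \<le> m ^ card I * q ^ ((m - 1) * card I)"
proof (rule ccontr)
  let ?n = "card I"
  let ?w0 = "q ^ ((m - 1) * ?n)"
  let ?wt = "\<lambda>x. card {y \<in> Y. \<forall>i\<in>I. y i (x i) = z i}"
  let ?T = "{(x, y). x \<in> X \<and> y \<in> Y \<and> (\<forall>i\<in>I. y i (x i) = z i)}"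
  assume "\<not> card ?T * k ^ C \<le> m ^ ?n * ?w0"
  then have big: "m ^ ?n * ?w0 < card ?T * k ^ C" by simp
  have m: "m \<ge> 1" using k by simp
  have finXs: "finite (I \<rightarrow>\<^sub>E {..<m})" and finYs: "finite (I \<rightarrow>\<^sub>E words m q)"
    using finite_I by (auto intro!: finite_PiE finite_words)
  have finX: "finite X" and finY: "finite Y"
    using X Y finXs finYs by (auto intro: finite_subset)
  have Xm: "x i < m" if "x \<in> X" "i \<in> I" for x i using that X by auto

  \<comment> \<open>A row is weighted by its columns in \<open>Y\<close> over \<open>z\<close>, so
    \<open>N\<close> counts the entries over \<open>z\<close> in a subcube of rows.\<close>
  define N where "N S a = (\<Sum>x\<in>{x\<in>X. \<forall>i\<in>S. x i = a i}. ?wt x)" for S and a :: "'i \<Rightarrow> nat"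
  define P where "P = Pow I \<times> (I \<rightarrow>\<^sub>E {..<m})"
  define g where "g = (\<lambda>(S, a). N S a * k ^ card S)"
  have "card ?T = N {} a" for a
  proof -
    have "?T = Sigma X (\<lambda>x. {y \<in> Y. \<forall>i\<in>I. y i (x i) = z i})" by auto
    then show ?thesis using finX finY by (simp add: N_def card_SigmaI)
  qed
  note T = this
  have finP: "finite P" using finite_I finXs by (auto simp: P_def)
  have "(\<lambda>i\<in>I. 0) \<in> I \<rightarrow>\<^sub>E {..<m}" using m by auto
  then have P0: "({}, \<lambda>i\<in>I. 0) \<in> P" by (auto simp: P_def)
  have "Max (g ` P) \<in> g ` P" using finP P0 by (intro Max_in) auto
  then obtain S a where Sa: "(S, a) \<in> P" "g (S, a) = Max (g ` P)" by fastforce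
  have max: "N S' a' * k ^ card S' \<le> N S a * k ^ card S" if "(S', a') \<in> P" for S' a'
  proof -
    have "g (S', a') \<le> Max (g ` P)" using finP that by (intro Max_ge) auto
    then show ?thesis using Sa by (simp add: g_def)
  qed
  have S: "S \<subseteq> I" "finite S" and a: "a \<in> I \<rightarrow>\<^sub>E {..<m}"
    using Sa finite_I by (auto simp: P_def intro: finite_subset)
  have lower: "card ?T \<le> N S a * k ^ card S"
    using max[OF P0] T by simp

  have wt: "?wt x \<le> ?w0" if "x \<in> X" for x
  proof -
    have "?wt x \<le> card {y \<in> I \<rightarrow>\<^sub>E words m q. \<forall>i\<in>I. y i (x i) = z i}"
      using Y finYs by (intro card_mono) auto
    also have "\<dots> = ?w0" using that Xm z by (intro card_words_through finite_I) auto
    finally show ?thesis .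
  qed
  have "N S a \<le> (\<Sum>x\<in>{x\<in>X. \<forall>i\<in>S. x i = a i}. ?w0)"
    unfolding N_def using wt by (intro sum_mono) auto
  also have "\<dots> = card {x\<in>X. \<forall>i\<in>S. x i = a i} * ?w0" by simp
  also have "\<dots> \<le> card {x \<in> I \<rightarrow>\<^sub>E {..<m}. \<forall>i\<in>S. x i = a i} * ?w0"
    using X finXs by (intro mult_right_mono card_mono) auto
  also have "card {x \<in> I \<rightarrow>\<^sub>E {..<m}. \<forall>i\<in>S. x i = a i} = m ^ (?n - card S)"
    using S a finite_I by (intro card_PiE_fixed) auto
  finally have upper: "N S a \<le> m ^ (?n - card S) * ?w0" .
  have cS: "card S \<le> ?n" using S finite_I by (intro card_mono)
  \<comment> \<open>Fixing a coordinate gains \<open>k\<close> in the maximised quantity but loses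
    \<open>m = k\<^sup>2\<close> in the volume bound \<open>upper\<close>. The excess
    \<open>k ^ C\<close> pays for at most \<open>C\<close> such net losses.\<close>
  have "m ^ ?n * ?w0 < (m ^ (?n - card S) * ?w0) * k ^ card S * k ^ C"
    using big lower upper by (meson le_trans less_le_trans mult_le_mono1)
  moreover have "m ^ ?n = m ^ (?n - card S) * m ^ card S"
    using cS by (simp flip: power_add)
  ultimately have "m ^ (?n - card S) * ?w0 * m ^ card S < m ^ (?n - card S) * ?w0 * (k ^ card S * k ^ C)"
    by (simp add: ac_simps)
  then have "m ^ card S < k ^ card S * k ^ C" by simp
  then have "k ^ (2 * card S) < k ^ (card S + C)"
    using k(2) by (simp add: power_mult power_add)
  then have SC: "card S \<le> C"
    using k(1) by (simp add: power_strict_increasing_iff)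
  then obtain c where c: "c \<in> Cs" "\<And>i. i \<in> S \<Longrightarrow> i \<in> dm c \<Longrightarrow> z i = vl c i"
    using rob S unfolding robust_def by blast

  define D where "D = dm c - S"
  define X' where "X' = {x\<in>X. \<forall>i\<in>S. x i = a i}"
  have D: "finite D" "D \<subseteq> I" "card D \<le> w"
  proof -
    have fin: "finite (dm c)" using dm_subset[OF c(1)] finite_I by (rule finite_subset)
    then show "finite D" "D \<subseteq> I" using dm_subset[OF c(1)] by (auto simp: D_def)
    have "card D \<le> card (dm c)" using fin by (intro card_mono) (auto simp: D_def)
    then show "card D \<le> w" using w(1)[OF c(1)] by simp
  qed
  have Npos: "N S a > 0" using lower big by (cases "N S a") auto
  have Nsum: "real (N S a) = (\<Sum>x\<in>X'. real (?wt x))" by (simp add: N_def X'_def)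
  have "spread D m X' (\<lambda>x. real (?wt x)) (real k) (real (N S a))"
    unfolding spread_def
  proof (intro allI impI ballI)
    fix J b assume J: "J \<subseteq> D" and b: "b \<in> J \<rightarrow>\<^sub>E {..<m}"
    define a' where "a' = (\<lambda>i\<in>I. if i \<in> J then b i else a i)"
    have fJ: "finite J" "S \<inter> J = {}" "J \<subseteq> I" using J D finite_subset by (auto simp: D_def)
    have "{x\<in>X'. \<forall>j\<in>J. x j = b j} = {x\<in>X. \<forall>i\<in>S \<union> J. x i = a' i}"
      using fJ S by (auto simp: X'_def a'_def)
    then have eq: "(\<Sum>x\<in>{x\<in>X'. \<forall>j\<in>J. x j = b j}. real (?wt x)) = real (N (S \<union> J) a')"
      by (simp add: N_def)
    have "(S \<union> J, a') \<in> P" using S fJ a b by (auto simp: P_def a'_def PiE_iff)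
    then have "N (S \<union> J) a' * k ^ card (S \<union> J) \<le> N S a * k ^ card S" by (rule max)
    then have "(N (S \<union> J) a' * k ^ card J) * k ^ card S \<le> N S a * k ^ card S"
      using S fJ by (simp add: card_Un_disjoint power_add ac_simps)
    then have "N (S \<union> J) a' * k ^ card J \<le> N S a" using k by simp
    then have "real (N (S \<union> J) a' * k ^ card J) \<le> real (N S a)" by (simp only: of_nat_le_iff)
    then show "(\<Sum>x\<in>{x\<in>X'. \<forall>j\<in>J. x j = b j}. real (?wt x)) \<le> real (N S a) / real k ^ card J"
      unfolding eq using k by (simp add: pos_le_divide_eq)
  qed
  \<comment> \<open>With \<open>e = 1 / (4 * w)\<close> the drift over at most \<open>w\<close>
    coordinates is at most \<open>exp 1\<close>, well within the slack \<open>8\<close>. The same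
    choice of \<open>e\<close> produces the constant \<open>512 = 32 * 4\<^sup>2\<close>.\<close>
  moreover have "real (N S a) * (1 + 4 * (1 / (4 * real w))) ^ card D \<le> 8 * real (N S a)"
  proof -
    have "(1 + 4 * (1 / (4 * real w))) ^ card D \<le> (1 + 1 / real w) ^ w"
      using D by (simp add: power_increasing)
    also have "\<dots> \<le> exp (1 / real w) ^ w" by (intro power_mono) (auto intro: exp_ge_add_one_self)
    also have "\<dots> = exp 1" using w(2) by (simp flip: exp_of_nat_mult)
    also have "\<dots> \<le> 8" using exp_le by simp
    finally show ?thesis by (simp add: mult.commute mult_left_mono)
  qed
  ultimately have missed: "real (card (missed D m q X' (vl c)))
    \<le> real (q ^ m) ^ card D * (card D * ((2 * real m) ^ card D + 1) * exp (- (1 / (4 * real w))\<^sup>2 * real k / (32 * real q)))"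
    using D finX Xm Npos Nsum k m w vl_less[OF c(1)]
    by (intro card_missed[where w = "\<lambda>x. real (?wt x)" and A = "N S a" and B = "N S a"])
       (auto simp: X'_def D_def field_simps)
  define u where "u = real w * ((2 * real m) ^ w + 1) * exp (- real k / (512 * (real w)\<^sup>2 * real q))"
  have "real (card D) * ((2 * real m) ^ card D + 1) * exp (- (1 / (4 * real w))\<^sup>2 * real k / (32 * real q)) \<le> u"
  proof -
    have "- (1 / (4 * real w))\<^sup>2 * real k / (32 * real q) = - real k / (512 * (real w)\<^sup>2 * real q)"
      using w by (simp add: power2_eq_square)
    moreover have "real (card D) * ((2 * real m) ^ card D + 1) \<le> real w * ((2 * real m) ^ w + 1)"
      using D m by (intro mult_mono add_right_mono power_increasing) auto
    ultimately show ?thesis unfolding u_def by (simp add: mult_right_mono)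
  qed
  then have "real (q ^ m) ^ card D * (real (card D) * ((2 * real m) ^ card D + 1) * exp (- (1 / (4 * real w))\<^sup>2 * real k / (32 * real q)))
      \<le> real (q ^ m) ^ card D * u"
    by (intro mult_left_mono) auto
  with missed have missed': "real (card (missed D m q X' (vl c))) \<le> real (q ^ m) ^ card D * u"
    by linarith

  \<comment> \<open>The rows of \<open>X'\<close> share their pointers on \<open>S\<close>, so a
    column over \<open>z\<close> at one of them reads \<open>z\<close>, and hence agrees with
    \<open>c\<close>, on \<open>S \<inter> dm c\<close> from all of them. If one of these rows also
    read \<open>c\<close> on \<open>D\<close>, the rectangle would contain an entry satisfying
    \<open>c\<close>.\<close>
  let ?Y' = "{y \<in> Y. \<exists>x\<in>X'. \<forall>i\<in>I. y i (x i) = z i}"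
  have "?Y' \<subseteq> {y \<in> I \<rightarrow>\<^sub>E words m q. restrict y D \<in> missed D m q X' (vl c)}"
  proof
    fix y assume "y \<in> ?Y'"
    then obtain x0 where y: "y \<in> Y" "x0 \<in> X'" "\<And>i. i \<in> I \<Longrightarrow> y i (x0 i) = z i" by blast
    have "\<not> (\<forall>i\<in>D. y i (x i) = vl c i)" if "x \<in> X'" for x
    proof
      assume D': "\<forall>i\<in>D. y i (x i) = vl c i"
      have "y i (x i) = vl c i" if i: "i \<in> dm c" for i
      proof (cases "i \<in> S")
        case True
        then have "x i = x0 i" using \<open>x \<in> X'\<close> y(2) by (simp add: X'_def)
        then show ?thesis using c(2)[OF True i] y(3)[of i] True S by auto
      qed (use D' i in \<open>auto simp: D_def\<close>)
      then have "sat (\<lambda>i. y i (x i))" using c(1) by (auto simp: sat_def)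
      then show False using unsat y(1) that by (auto simp: X'_def)
    qed
    then show "y \<in> {y \<in> I \<rightarrow>\<^sub>E words m q. restrict y D \<in> missed D m q X' (vl c)}"
      using y(1) Y D by (fastforce simp: missed_def)
  qed
  then have "card ?Y' \<le> card {y \<in> I \<rightarrow>\<^sub>E words m q. restrict y D \<in> missed D m q X' (vl c)}"
    using finYs by (intro card_mono) auto
  also have "\<dots> \<le> card (missed D m q X' (vl c)) * (\<Prod>i\<in>I - D. card (words m q))"
    using D finite_I by (intro card_PiE_restrict_le) (auto simp: finite_missed finite_words)
  finally have "real (card ?Y') \<le> real (card (missed D m q X' (vl c))) * real (q ^ m) ^ (?n - card D)"
    using D by (simp add: card_words card_Diff_subset flip: of_nat_power of_nat_mult)
  also have "\<dots> \<le> real (q ^ m) ^ card D * u * real (q ^ m) ^ (?n - card D)"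
    using missed' by (intro mult_right_mono) auto
  also have "\<dots> = real (q ^ m) ^ ?n * u"
  proof -
    have "card D \<le> ?n" using D finite_I by (intro card_mono)
    then have "real (q ^ m) ^ ?n = real (q ^ m) ^ card D * real (q ^ m) ^ (?n - card D)"
      by (simp flip: power_add)
    then show ?thesis by simp
  qed
  finally have Y': "real (card ?Y') \<le> real (q ^ m) ^ ?n * u" .
  have "N S a = card (Sigma X' (\<lambda>x. {y \<in> Y. \<forall>i\<in>I. y i (x i) = z i}))"
    using finX finY by (simp add: N_def X'_def card_SigmaI)
  also have "\<dots> \<le> card ((I \<rightarrow>\<^sub>E {..<m}) \<times> ?Y')"
    using finXs finY X by (intro card_mono) (auto simp: X'_def)
  also have "\<dots> = m ^ ?n * card ?Y'"
    using finite_I by (simp add: card_cartesian_product card_PiE)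
  finally have "real (N S a) \<le> real (m ^ ?n) * real (card ?Y')"
    by (simp flip: of_nat_mult del: of_nat_power)
  also have "\<dots> \<le> real (m ^ ?n) * (real (q ^ m) ^ ?n * u)"
    using Y' by (intro mult_left_mono) auto
  finally have NY: "real (N S a) \<le> real (m ^ ?n) * (real (q ^ m) ^ ?n * u)" .
  \<comment> \<open>The factor \<open>k ^ (2 * C)\<close> in \<open>small\<close> comes from
    \<open>card S \<le> C\<close>, and \<open>q ^ card I\<close> from comparing all
    \<open>q ^ m\<close> words of a variable with the \<open>q ^ (m - 1)\<close> words over
    \<open>z\<close>.\<close>
  have "real (m ^ ?n) * real ?w0 < real (card ?T) * real k ^ C"
    using big by (simp flip: of_nat_mult of_nat_power)
  also have "\<dots> \<le> real (N S a) * real k ^ card S * real k ^ C"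
    using lower by (intro mult_right_mono) (simp_all flip: of_nat_mult of_nat_power)
  also have "\<dots> \<le> real (N S a) * real k ^ C * real k ^ C"
    using SC k by (intro mult_right_mono mult_left_mono power_increasing) auto
  also have "\<dots> = real (N S a) * real k ^ (2 * C)"
    by (simp add: power_add mult_2)
  also have "\<dots> \<le> real (m ^ ?n) * (real (q ^ m) ^ ?n * u) * real k ^ (2 * C)"
    using NY by (intro mult_right_mono) auto
  also have "\<dots> = real (m ^ ?n) * real ?w0 * (u * real q ^ ?n * real k ^ (2 * C))"
  proof -
    have "real (q ^ m) ^ ?n = real q ^ ?n * real ?w0"
      using m by (cases m) (simp_all add: power_mult_distrib power_mult)
    then show ?thesis by simp
  qed
  also have "\<dots> \<le> real (m ^ ?n) * real ?w0 * 1"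
    using small unfolding u_def by (intro mult_left_mono) auto
  finally show False by simp
qed

end

section \<open>An unambiguous DNF from cross-intersecting families\<close>

text \<open>The variables are \<open>t\<close> copies of the cells, together with a table that has, for every
  \<open>b \<subseteq> {..<t}\<close>, an entry naming \<open>t\<close> sets of cells by lists of length \<open>r\<close>.\<close>
definition sheet_vars :: "'v set \<Rightarrow> nat \<Rightarrow> nat \<Rightarrow> (nat \<times> 'v + nat set \<times> nat \<times> nat) set" where
  "sheet_vars V t r = ({..<t} \<times> V) <+> (Pow {..<t} \<times> {..<t} \<times> {..<r})"

text \<open>Lists of fixed length, with repetitions, give edges of all sizes one table format, and a
  list prescribes the content of every slot.\<close>

definition sheet_certs :: "'v set \<Rightarrow> (bool \<Rightarrow> 'v set set) \<Rightarrow> nat \<Rightarrow> nat \<Rightarrow> (nat set \<times> (nat \<times> nat \<Rightarrow> 'v)) set" where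
  "sheet_certs V E t r = {(b, L). b \<subseteq> {..<t} \<and> L \<in> {..<t} \<times> {..<r} \<rightarrow>\<^sub>E V
     \<and> (\<forall>i<t. (\<lambda>k. L (i, k)) ` {..<r} \<in> E (i \<in> b))}"

definition sheet_dom :: "nat \<Rightarrow> nat \<Rightarrow> nat set \<times> (nat \<times> nat \<Rightarrow> 'v) \<Rightarrow> (nat \<times> 'v + nat set \<times> nat \<times> nat) set" where
  "sheet_dom t r = (\<lambda>(b, L). (\<lambda>(i, k). Inl (i, L (i, k))) ` ({..<t} \<times> {..<r})
     \<union> (\<lambda>(i, k). Inr (b, i, k)) ` ({..<t} \<times> {..<r}))"

definition sheet_val :: "('v \<Rightarrow> nat) \<Rightarrow> nat set \<times> (nat \<times> nat \<Rightarrow> 'v) \<Rightarrow> nat \<times> 'v + nat set \<times> nat \<times> nat \<Rightarrow> nat" where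
  "sheet_val enc = (\<lambda>(b, L) x. case x of Inl (i, v) \<Rightarrow> if i \<in> b then 1 else 0 | Inr (b', i, k) \<Rightarrow> enc (L (i, k)))"

text \<open>In \<open>survive\<close> only cells of player \<open>s\<close> are deleted, because the
  assignment \<open>blank\<close> below agrees with an edge of \<open>E s\<close> on all other
  cells. By \<open>h < 2 ^ t\<close>, any \<open>h\<close> variables leave some table entry
  untouched. The symbol \<open>0\<close> is kept out of the range of \<open>enc\<close> to mark
  empty slots.\<close>

locale hypergraph_pair =
  fixes V :: "(bool \<times> 'a) set" and E :: "bool \<Rightarrow> (bool \<times> 'a) set set" and r h t q :: nat and enc :: "bool \<times> 'a \<Rightarrow> nat"
  assumes finite_V: "finite V"
    and edge: "e \<in> E s \<Longrightarrow> e \<subseteq> V \<and> e \<noteq> {} \<and> card e \<le> r"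
    and cross: "e \<in> E True \<Longrightarrow> e' \<in> E False \<Longrightarrow> e \<inter> e' \<noteq> {}"
    and survive: "finite A \<Longrightarrow> card A \<le> h \<Longrightarrow> \<exists>e\<in>E s. \<forall>a\<in>A. (s, a) \<notin> e"
    and enc: "inj_on enc V" "enc ` V \<subseteq> {1..<q}" and q: "q \<ge> 2" and t: "t > 0" "h < 2 ^ t"
begin

lemma sheet_edge:
  assumes "(b, L) \<in> sheet_certs V E t r" "i < t"
  shows "(\<lambda>k. L (i, k)) ` {..<r} \<in> E (i \<in> b)"
  using assms by (auto simp: sheet_certs_def)

text \<open>With equal \<open>b\<close> the two certificates prescribe different lists for the same
  table entry. Otherwise some copy has opposite values, and the two edges there meet in a cell that
  is required to be both \<open>1\<close> and \<open>0\<close>.\<close>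

lemma sheet_conflict:
  assumes c: "(b, L) \<in> sheet_certs V E t r" "(b', L') \<in> sheet_certs V E t r" "(b, L) \<noteq> (b', L')"
  shows "\<exists>x\<in>sheet_dom t r (b, L) \<inter> sheet_dom t r (b', L'). sheet_val enc (b, L) x \<noteq> sheet_val enc (b', L') x"
proof (cases "b = b'")
  case True
  have L: "L \<in> {..<t} \<times> {..<r} \<rightarrow>\<^sub>E V" "L' \<in> {..<t} \<times> {..<r} \<rightarrow>\<^sub>E V"
    using c by (auto simp: sheet_certs_def)
  have "L \<noteq> L'" using c(3) True by simp
  then obtain p where p: "p \<in> {..<t} \<times> {..<r}" "L p \<noteq> L' p"
    using L by (meson PiE_ext)
  then have "enc (L p) \<noteq> enc (L' p)" using enc(1) L by (metis PiE_mem inj_on_def)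
  then show ?thesis using p True
    by (cases p) (auto simp: sheet_dom_def sheet_val_def intro!: bexI[of _ "Inr (b', p)"])
next
  case False
  then obtain i where i: "i < t" "(i \<in> b) \<noteq> (i \<in> b')"
    using c by (auto simp: sheet_certs_def)
  let ?e = "(\<lambda>k. L (i, k)) ` {..<r}" and ?e' = "(\<lambda>k. L' (i, k)) ` {..<r}"
  have "?e \<inter> ?e' \<noteq> {}"
    using sheet_edge[OF c(1) i(1)] sheet_edge[OF c(2) i(1)] cross[of ?e ?e'] cross[of ?e' ?e] i(2)
    by (cases "i \<in> b") auto
  then obtain v where v: "v \<in> ?e" "v \<in> ?e'" by blast
  have "Inl (i, v) \<in> sheet_dom t r (b, L) \<inter> sheet_dom t r (b', L')"
    using v i by (auto simp: sheet_dom_def)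
  then show ?thesis using i(2) by (intro bexI[of _ "Inl (i, v)"]) (auto simp: sheet_val_def)
qed

lemma finite_sheet_certs: "finite (sheet_certs V E t r)"
  and card_sheet_certs: "card (sheet_certs V E t r) \<le> 2 ^ t * card V ^ (t * r)"
proof -
  let ?B = "Pow {..<t} \<times> ({..<t} \<times> {..<r} \<rightarrow>\<^sub>E V)"
  have sub: "sheet_certs V E t r \<subseteq> ?B" by (auto simp: sheet_certs_def)
  have fin: "finite ?B" using finite_V by (auto intro!: finite_PiE)
  show "finite (sheet_certs V E t r)" using finite_subset[OF sub fin] .
  have "card ?B = 2 ^ t * card V ^ (t * r)"
    by (simp add: card_cartesian_product card_Pow card_PiE)
  then show "card (sheet_certs V E t r) \<le> 2 ^ t * card V ^ (t * r)"
    using card_mono[OF fin sub] by simp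
qed

lemma finite_sheet_vars: "finite (sheet_vars V t r)"
  and card_sheet_vars: "card (sheet_vars V t r) = t * card V + 2 ^ t * (t * r)"
  using finite_V by (simp_all add: sheet_vars_def card_Plus card_cartesian_product card_Pow)

lemma card_sheet_dom:
  fixes c :: "nat set \<times> (nat \<times> nat \<Rightarrow> bool \<times> 'a)"
  shows "card (sheet_dom t r c) \<le> 2 * (t * r)"
proof -
  have "card (f ` ({..<t} \<times> {..<r}) \<union> g ` ({..<t} \<times> {..<r})) \<le> 2 * (t * r)"
    for f g :: "nat \<times> nat \<Rightarrow> nat \<times> bool \<times> 'a + nat set \<times> nat \<times> nat"
    using card_Un_le[of "f ` ({..<t} \<times> {..<r})" "g ` ({..<t} \<times> {..<r})"]
      card_image_le[of "{..<t} \<times> {..<r}" f] card_image_le[of "{..<t} \<times> {..<r}" g]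
    by (simp add: card_cartesian_product)
  then show ?thesis by (cases c) (simp add: sheet_dom_def)
qed

sublocale unambiguous_dnf "sheet_vars V t r" "sheet_certs V E t r" "sheet_dom t r" "sheet_val enc" q
proof
  show "finite (sheet_vars V t r)" by (rule finite_sheet_vars)
  show "finite (sheet_certs V E t r)" by (rule finite_sheet_certs)
next
  fix c assume c: "c \<in> sheet_certs V E t r"
  obtain b L where bL: "c = (b, L)" by (cases c)
  have L: "L (i, k) \<in> V" if "i < t" "k < r" for i k
    using c that unfolding bL sheet_certs_def by (auto simp: PiE_iff)
  have b: "b \<subseteq> {..<t}" using c unfolding bL sheet_certs_def by auto
  show "sheet_dom t r c \<subseteq> sheet_vars V t r"
    using L b by (auto simp: bL sheet_dom_def sheet_vars_def)
  show "sheet_val enc c x < q" if "x \<in> sheet_dom t r c" for x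
  proof -
    have "enc (L (i, k)) < q" if "i < t" "k < r" for i k using L[OF that] enc(2) by auto
    then show ?thesis using that q by (auto simp: bL sheet_dom_def sheet_val_def)
  qed
  show "\<exists>x\<in>sheet_dom t r c \<inter> sheet_dom t r c'. sheet_val enc c x \<noteq> sheet_val enc c' x"
    if "c' \<in> sheet_certs V E t r" "c \<noteq> c'" for c'
    using sheet_conflict[of b L "fst c'" "snd c'"] c that by (simp add: bL)
qed

text \<open>The cells \<open>(s, a)\<close> contradict the certificates of the value \<open>s\<close> and all other cells agree
  with them. The entries of the table name no cells, because \<open>enc\<close> avoids \<open>0\<close>.\<close>
definition blank :: "nat \<times> bool \<times> 'a + nat set \<times> nat \<times> nat \<Rightarrow> nat" where
  "blank x = (case x of Inl (i, s, a) \<Rightarrow> if s then 0 else 1 | Inr _ \<Rightarrow> 0)"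

lemma blank_less: "blank x < q"
  using q by (auto simp: blank_def split: sum.split prod.split)

lemma not_sat_blank: "\<not> sat blank"
proof
  assume "sat blank"
  then obtain b L where c: "(b, L) \<in> sheet_certs V E t r"
      "\<And>x. x \<in> sheet_dom t r (b, L) \<Longrightarrow> blank x = sheet_val enc (b, L) x"
    unfolding sat_def by auto
  have "(\<lambda>k. L (0, k)) ` {..<r} \<noteq> {}" using edge[OF sheet_edge[OF c(1) t(1)]] by blast
  then have r: "r > 0" by auto
  then have "Inr (b, 0, 0) \<in> sheet_dom t r (b, L)" using t(1) by (auto simp: sheet_dom_def)
  then have "enc (L (0, 0)) = 0" using c(2) by (force simp: blank_def sheet_val_def)
  moreover have "L (0, 0) \<in> V" using c(1) t(1) r by (auto simp: sheet_certs_def PiE_iff)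
  ultimately show False using enc(2) by force
qed

text \<open>A small set of variables leaves the table entry of some \<open>b\<close> untouched, and every copy then
  has a certificate of the value prescribed by \<open>b\<close> that avoids the variables contradicting it.\<close>
lemma robust_blank: "robust blank h"
  unfolding robust_def
proof (intro allI impI)
  fix S assume S: "S \<subseteq> sheet_vars V t r" "card S \<le> h"
  have finS: "finite S" using S finite_sheet_vars by (auto intro: finite_subset)
  let ?T = "(\<lambda>x. case x of Inl _ \<Rightarrow> {} | Inr (b, _) \<Rightarrow> b) ` S"
  have "card ?T \<le> h" using S(2) card_image_le[OF finS] le_trans by blast
  then have "card ?T < card (Pow {..<t})" using t by (simp add: card_Pow)
  then have "\<not> Pow {..<t} \<subseteq> ?T" using card_mono[of ?T "Pow {..<t}"] finS by auto
  then obtain b where b: "b \<subseteq> {..<t}" "b \<notin> ?T" by blast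
  then have entry: "Inr (b, x) \<notin> S" for x by (force intro: image_eqI)
  have "\<exists>l. l ` {..<r} \<in> E (i \<in> b) \<and> (\<forall>a. Inl (i, (i \<in> b), a) \<in> S \<longrightarrow> ((i \<in> b), a) \<notin> l ` {..<r})" for i
  proof -
    let ?A = "{a. Inl (i, (i \<in> b), a) \<in> S}"
    have A: "finite ?A" "card ?A \<le> card S"
    proof -
      have "(\<lambda>a. Inl (i, (i \<in> b), a)) ` ?A \<subseteq> S" by auto
      moreover have "inj_on (\<lambda>a. Inl (i, (i \<in> b), a) :: nat \<times> bool \<times> 'a + nat set \<times> nat \<times> nat) ?A"
        by (auto simp: inj_on_def)
      ultimately show "finite ?A" "card ?A \<le> card S"
        using finS by (auto intro: inj_on_finite card_inj_on_le)
    qed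
    then obtain e where e: "e \<in> E (i \<in> b)" "\<And>a. a \<in> ?A \<Longrightarrow> ((i \<in> b), a) \<notin> e"
      using survive[of ?A "i \<in> b"] S(2) by auto
    have fe: "finite e" "e \<noteq> {}" "card e \<le> r"
      using edge[OF e(1)] finite_V by (auto intro: finite_subset)
    obtain l where l: "bij_betw l {0..<card e} e" using ex_bij_betw_nat_finite[OF fe(1)] by blast
    obtain v where v: "v \<in> e" using fe by blast
    \<comment> \<open>An edge with fewer than \<open>r\<close> cells is listed by repeating one of
      them, which leaves the set of listed cells unchanged.\<close>
    have eq: "(\<lambda>k. if k < card e then l k else v) ` {..<r} = e"
    proof
      have le: "l ` {0..<card e} = e" using l by (simp add: bij_betw_def)
      then show "(\<lambda>k. if k < card e then l k else v) ` {..<r} \<subseteq> e" using v by auto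
      show "e \<subseteq> (\<lambda>k. if k < card e then l k else v) ` {..<r}"
      proof
        fix x assume "x \<in> e"
        then have "x \<in> l ` {0..<card e}" unfolding le .
        then obtain k where "k < card e" "x = l k" by auto
        then show "x \<in> (\<lambda>k. if k < card e then l k else v) ` {..<r}"
          using fe(3) by (intro image_eqI[of _ _ k]) auto
      qed
    qed
    show ?thesis
      by (rule exI[of _ "\<lambda>k. if k < card e then l k else v"], unfold eq) (use e in auto)
  qed
  then obtain l where l: "\<And>i. l i ` {..<r} \<in> E (i \<in> b)"
      "\<And>i a. Inl (i, (i \<in> b), a) \<in> S \<Longrightarrow> ((i \<in> b), a) \<notin> l i ` {..<r}"
    by moura
  define L where "L = (\<lambda>(i, k)\<in>{..<t} \<times> {..<r}. l i k)"
  have Lr: "(\<lambda>k. L (i, k)) ` {..<r} = l i ` {..<r}" if "i < t" for i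
    using that by (auto simp: L_def)
  have "L \<in> {..<t} \<times> {..<r} \<rightarrow>\<^sub>E V"
  proof -
    have "l i k \<in> V" if "k < r" for i k using edge[OF l(1)[of i]] that by blast
    then show ?thesis by (auto simp: L_def)
  qed
  then have bL: "(b, L) \<in> sheet_certs V E t r"
    using b l(1) Lr by (auto simp: sheet_certs_def)
  moreover have "\<forall>x\<in>S \<inter> sheet_dom t r (b, L). blank x = sheet_val enc (b, L) x"
  proof
    fix x assume x: "x \<in> S \<inter> sheet_dom t r (b, L)"
    then obtain i k where ik: "i < t" "k < r" "x = Inl (i, l i k)"
      using entry by (auto simp: sheet_dom_def L_def)
    obtain s a where sa: "l i k = (s, a)" by (cases "l i k")
    \<comment> \<open>The edge was chosen to avoid the cells of player \<open>i \<in> b\<close> in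
      \<open>S\<close>; those of the opponent have in \<open>blank\<close> the value that
      \<open>b\<close> prescribes.\<close>
    have "s \<noteq> (i \<in> b)"
    proof
      assume "s = (i \<in> b)"
      then have "((i \<in> b), a) \<notin> l i ` {..<r}" using x ik sa by (intro l(2)) simp
      moreover have "l i k \<in> l i ` {..<r}" using ik by (intro imageI) simp
      ultimately show False using sa \<open>s = (i \<in> b)\<close> by simp
    qed
    then show "blank x = sheet_val enc (b, L) x"
      using ik sa by (auto simp: blank_def sheet_val_def)
  qed
  ultimately show "\<exists>c\<in>sheet_certs V E t r. \<forall>i\<in>S \<inter> sheet_dom t r c. blank i = sheet_val enc c i"
    by blast
qed

end

section \<open>Ranks of matrices given by relations\<close>

lemma zero_one_mat_iff:
  "zero_one_mat M \<longleftrightarrow> (\<forall>i<dim_row M. \<forall>j<dim_col M. M $$ (i, j) = 0 \<or> M $$ (i, j) = 1)"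
proof
  assume "zero_one_mat M"
  then have "M $$ (i, j) \<in> {0, 1}" if "i < dim_row M" "j < dim_col M" for i j
    using that unfolding zero_one_mat_def by (blast intro: elements_matI[OF carrier_matI])
  then show "\<forall>i<dim_row M. \<forall>j<dim_col M. M $$ (i, j) = 0 \<or> M $$ (i, j) = 1" by simp
next
  assume *: "\<forall>i<dim_row M. \<forall>j<dim_col M. M $$ (i, j) = 0 \<or> M $$ (i, j) = 1"
  show "zero_one_mat M"
    unfolding zero_one_mat_def
  proof
    fix e assume "e \<in> elements_mat M"
    then obtain i j where "i < dim_row M" "j < dim_col M" "e = M $$ (i, j)"
      by (blast dest: elements_matD)
    then show "e \<in> {0, 1}" using * by blast
  qed
qed

text \<open>Rows of \<open>A\<close> with the same support give equal rows of \<open>M\<close>, and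
  there are at most \<open>2 ^ k\<close> supports. The zeros in the rows of one support form a
  single rectangle.\<close>

lemma boolean_factorization_complement:
  assumes M: "zero_one_mat M" and f: "binary_factorization M k"
  shows "boolean_factorization (complement_mat M) (2 ^ k)"
proof -
  obtain A B where A: "A \<in> carrier_mat (dim_row M) k" and B: "B \<in> carrier_mat k (dim_col M)"
    and AB: "zero_one_mat A" "zero_one_mat B" "M = A * B"
    using f unfolding binary_factorization_def by blast
  obtain h where h: "bij_betw h {0..<card (Pow {..<k})} (Pow {..<k})"
    using ex_bij_betw_nat_finite[of "Pow {..<k}"] by auto
  then have h: "bij_betw h {..<2 ^ k} (Pow {..<k})"
    by (simp add: card_Pow atLeast0LessThan)
  let ?s = "\<lambda>i. {l. l < k \<and> A $$ (i, l) = 1}"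
  define A' where "A' = mat (dim_row M) (2 ^ k) (\<lambda>(i, t). if ?s i = h t then 1 else (0 :: real))"
  define B' where "B' = mat (2 ^ k) (dim_col M) (\<lambda>(t, j). if \<forall>l\<in>h t. B $$ (l, j) = 0 then 1 else (0 :: real))"
  have dims: "dim_row A' = dim_row M" "dim_col A' = 2 ^ k" "dim_col B' = dim_col M"
    by (simp_all add: A'_def B'_def)
  have "complement_mat M = boolean_mult_mat A' B'"
  proof (rule eq_matI)
    fix i j assume "i < dim_row (boolean_mult_mat A' B')" "j < dim_col (boolean_mult_mat A' B')"
    then have ij: "i < dim_row M" "j < dim_col M"
      by (simp_all add: boolean_mult_mat_def A'_def B'_def)
    have a: "A $$ (i, l) = 0 \<or> A $$ (i, l) = 1" if "l < k" for l
      using AB(1) A ij that unfolding zero_one_mat_iff by auto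
    have b: "B $$ (l, j) = 0 \<or> B $$ (l, j) = 1" if "l < k" for l
      using AB(2) B ij that unfolding zero_one_mat_iff by auto
    have "M $$ (i, j) = (\<Sum>l\<in>{0..<k}. A $$ (i, l) * B $$ (l, j))"
      using A B ij by (subst AB(3)) (auto simp: scalar_prod_def)
    also have "\<dots> = 0 \<longleftrightarrow> (\<forall>l\<in>{0..<k}. A $$ (i, l) * B $$ (l, j) = 0)"
      using a b by (intro sum_nonneg_eq_0_iff) fastforce+
    also have "\<dots> \<longleftrightarrow> (\<forall>l\<in>?s i. B $$ (l, j) = 0)"
    proof -
      have "A $$ (i, l) * B $$ (l, j) = 0 \<longleftrightarrow> (A $$ (i, l) = 1 \<longrightarrow> B $$ (l, j) = 0)" if "l < k" for l
        using a[OF that] by auto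
      then show ?thesis by auto
    qed
    also have "\<dots> \<longleftrightarrow> (\<exists>t<2 ^ k. A' $$ (i, t) = 1 \<and> B' $$ (t, j) = 1)"
    proof
      assume *: "\<forall>l\<in>?s i. B $$ (l, j) = 0"
      have "?s i \<in> h ` {..<2 ^ k}" using bij_betw_imp_surj_on[OF h] by auto
      then obtain t where "t < 2 ^ k" "h t = ?s i" by auto
      then show "\<exists>t<2 ^ k. A' $$ (i, t) = 1 \<and> B' $$ (t, j) = 1"
        using * ij by (intro exI[of _ t]) (simp add: A'_def B'_def)
    next
      assume "\<exists>t<2 ^ k. A' $$ (i, t) = 1 \<and> B' $$ (t, j) = 1"
      then obtain t where "?s i = h t" "\<forall>l\<in>h t. B $$ (l, j) = 0"
        using ij by (auto simp: A'_def B'_def split: if_splits)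
      then show "\<forall>l\<in>?s i. B $$ (l, j) = 0" by (simp only:)
    qed
    finally have *: "M $$ (i, j) = 0 \<longleftrightarrow> (\<exists>t<2 ^ k. A' $$ (i, t) = 1 \<and> B' $$ (t, j) = 1)" .
    have **: "M $$ (i, j) = 0 \<or> M $$ (i, j) = 1" using M ij unfolding zero_one_mat_iff by auto
    show "complement_mat M $$ (i, j) = boolean_mult_mat A' B' $$ (i, j)"
    proof -
      have "boolean_mult_mat A' B' $$ (i, j) = (if \<exists>t<2 ^ k. A' $$ (i, t) = 1 \<and> B' $$ (t, j) = 1 then 1 else 0)"
        using ij dims by (simp add: boolean_mult_mat_def)
      moreover have "complement_mat M $$ (i, j) = 1 - M $$ (i, j)"
        using ij by (simp add: complement_mat_def)
      ultimately show ?thesis using * ** by auto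
    qed
  qed (simp_all add: boolean_mult_mat_def complement_mat_def A'_def B'_def)
  moreover have "zero_one_mat A'" "zero_one_mat B'"
    by (auto simp: zero_one_mat_iff A'_def B'_def)
  moreover have "A' \<in> carrier_mat (dim_row (complement_mat M)) (2 ^ k)" "B' \<in> carrier_mat (2 ^ k) (dim_col (complement_mat M))"
    by (auto simp: A'_def B'_def complement_mat_def)
  ultimately show ?thesis unfolding boolean_factorization_def by blast
qed

text \<open>Serves as a lower bound on the binary rank: matrices with growing Boolean rank of the
  complement realise infinitely many binary ranks.\<close>

lemma boolean_rank_complement_le:
  assumes "zero_one_mat M"
  shows "boolean_rank (complement_mat M) \<le> 2 ^ binary_rank M"
proof -
  have "binary_factorization M (binary_rank M)"
    unfolding binary_rank_def using binary_factorization_dim_row[OF assms] by (rule LeastI)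
  then show ?thesis
    unfolding boolean_rank_def using assms by (intro Least_le boolean_factorization_complement)
qed

section \<open>Square regular matrices from finite relations\<close>

lemma card_mod_periodic:
  assumes "(b::nat) > 0"
  shows "card {j. j < a * b \<and> Q (j mod b)} = a * card {j. j < b \<and> Q j}"
proof (induction a)
  case (Suc a)
  have "{j. j < Suc a * b \<and> Q (j mod b)} = {j. j < a * b \<and> Q (j mod b)} \<union> (\<lambda>j. a * b + j) ` {j. j < b \<and> Q j}"
    (is "?L = ?A \<union> ?B")
  proof (intro equalityI subsetI)
    fix j assume j: "j \<in> ?L"
    show "j \<in> ?A \<union> ?B"
    proof (cases "j < a * b")
      case False
      then obtain s where s: "j = a * b + s" using le_Suc_ex not_less by blast
      then have "s < b" using j by simp
      then show ?thesis using j s by (auto intro!: image_eqI[of _ _ s])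
    qed (use j in auto)
  qed (use assms in auto)
  moreover have "card (?A \<union> ?B) = card ?A + card ?B"
    by (intro card_Un_disjoint) auto
  moreover have "card ?B = card {j. j < b \<and> Q j}" by (intro card_image) (auto simp: inj_on_def)
  ultimately show ?case using Suc by simp
qed auto

lemma card_bij_betw_Collect:
  assumes "bij_betw h {..<n} A"
  shows "card {j. j < n \<and> Q (h j)} = card {x \<in> A. Q x}"
proof -
  have "bij_betw h {j. j < n \<and> Q (h j)} {x \<in> A. Q x}"
    using assms by (auto simp: bij_betw_def inj_on_def)
  then show ?thesis by (rule bij_betw_same_card)
qed

locale finite_relation =
  fixes A :: "'r set" and B :: "'c set" and R :: "'r \<Rightarrow> 'c \<Rightarrow> bool" and r :: "nat \<Rightarrow> 'r" and c :: "nat \<Rightarrow> 'c"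
    and a b :: nat
  assumes r: "bij_betw r {..<a} A" and c: "bij_betw c {..<b} B" and pos: "a > 0" "b > 0"
begin

text \<open>Every row is repeated \<open>b\<close> times and every column \<open>a\<close> times, which makes the matrix square
  and equalises row and column sums without affecting the ranks.\<close>
definition sq_mat :: "real mat" where
  "sq_mat = mat (a * b) (a * b) (\<lambda>(i, j). if R (r (i mod a)) (c (j mod b)) then 1 else 0)"

lemma dim_sq_mat [simp]: "dim_row sq_mat = a * b" "dim_col sq_mat = a * b"
  by (simp_all add: sq_mat_def)

lemma zero_one_sq_mat: "zero_one_mat sq_mat"
  by (auto simp: zero_one_mat_iff sq_mat_def)

lemma card_A: "card A = a" and card_B: "card B = b" and finite_A: "finite A" and finite_B: "finite B"
  using r c bij_betw_same_card bij_betw_finite by fastforce+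

lemma r_in: "r (i mod a) \<in> A" and c_in: "c (i mod b) \<in> B"
  using r c pos by (auto simp: bij_betw_def)

text \<open>The repetitions give \<open>a * dr\<close> ones in every row and \<open>b * dc\<close>
  in every column, and both products count the ones of \<open>R\<close>.\<close>

lemma regular_sq_mat:
  assumes dr: "\<And>x. x \<in> A \<Longrightarrow> card {y \<in> B. R x y} = dr" and dc: "\<And>y. y \<in> B \<Longrightarrow> card {x \<in> A. R x y} = dc"
  shows "regular_mat sq_mat"
proof -
  have "card {(x, y). x \<in> A \<and> y \<in> B \<and> R x y} = card (Sigma A (\<lambda>x. {y \<in> B. R x y}))"
    by (rule arg_cong[of _ _ card]) auto
  also have "\<dots> = a * dr" using dr finite_A finite_B card_A by (simp add: card_SigmaI)
  finally have 1: "card {(x, y). x \<in> A \<and> y \<in> B \<and> R x y} = a * dr" .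
  have "card {(x, y). x \<in> A \<and> y \<in> B \<and> R x y} = card (prod.swap ` Sigma B (\<lambda>y. {x \<in> A. R x y}))"
    by (rule arg_cong[of _ _ card]) auto
  also have "\<dots> = card (Sigma B (\<lambda>y. {x \<in> A. R x y}))"
    by (intro card_image) (auto simp: inj_on_def)
  also have "\<dots> = b * dc" using dc finite_A finite_B card_B by (simp add: card_SigmaI)
  finally have eq: "a * dr = b * dc" using 1 by simp
  have "card {j. j < a * b \<and> sq_mat $$ (i, j) = 1} = a * dr" if "i < a * b" for i
  proof -
    have "{j. j < a * b \<and> sq_mat $$ (i, j) = 1} = {j. j < a * b \<and> R (r (i mod a)) (c (j mod b))}"
      using that by (auto simp: sq_mat_def split: if_splits)
    then show ?thesis
      using card_mod_periodic[OF pos(2), of a "\<lambda>j. R (r (i mod a)) (c j)"]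
        card_bij_betw_Collect[OF c, of "R (r (i mod a))"] dr[OF r_in] by simp
  qed
  moreover have "card {i. i < a * b \<and> sq_mat $$ (i, j) = 1} = b * dc" if "j < a * b" for j
  proof -
    have "{i. i < a * b \<and> sq_mat $$ (i, j) = 1} = {i. i < b * a \<and> R (r (i mod a)) (c (j mod b))}"
      using that by (auto simp: sq_mat_def mult.commute split: if_splits)
    then show ?thesis
      using card_mod_periodic[OF pos(1), of b "\<lambda>i. R (r i) (c (j mod b))"]
        card_bij_betw_Collect[OF r, of "\<lambda>x. R x (c (j mod b))"] dc[OF c_in] by simp
  qed
  ultimately show ?thesis
    unfolding regular_mat_def using eq zero_one_sq_mat by auto
qed

lemma binary_rank_sq_mat_le:
  assumes K: "finite K"
    and cover: "\<And>x y. x \<in> A \<Longrightarrow> y \<in> B \<Longrightarrow> card {k \<in> K. x \<in> P k \<and> y \<in> Q k} = (if R x y then 1 else 0)"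
  shows "binary_rank sq_mat \<le> card K"
proof -
  obtain h where h: "bij_betw h {..<card K} K"
    using ex_bij_betw_nat_finite[OF K] by (auto simp: atLeast0LessThan)
  define L where "L = mat (a * b) (card K) (\<lambda>(i, l). if r (i mod a) \<in> P (h l) then 1 else (0 :: real))"
  define U where "U = mat (card K) (a * b) (\<lambda>(l, j). if c (j mod b) \<in> Q (h l) then 1 else (0 :: real))"
  have "sq_mat = L * U"
  proof (rule eq_matI)
    fix i j assume "i < dim_row (L * U)" "j < dim_col (L * U)"
    then have ij: "i < a * b" "j < a * b" by (simp_all add: L_def U_def)
    let ?x = "r (i mod a)" and ?y = "c (j mod b)"
    have "(L * U) $$ (i, j) = (\<Sum>l\<in>{0..<card K}. L $$ (i, l) * U $$ (l, j))"
      using ij by (simp add: L_def U_def scalar_prod_def)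
    also have "\<dots> = (\<Sum>l\<in>{0..<card K}. if ?x \<in> P (h l) \<and> ?y \<in> Q (h l) then 1 else 0)"
      using ij by (intro sum.cong) (auto simp: L_def U_def)
    also have "\<dots> = real (card {l. l < card K \<and> ?x \<in> P (h l) \<and> ?y \<in> Q (h l)})"
      by (simp add: sum.If_cases atLeast0LessThan Int_def)
    also have "\<dots> = (if R ?x ?y then 1 else 0)"
      using card_bij_betw_Collect[OF h, of "\<lambda>k. ?x \<in> P k \<and> ?y \<in> Q k"] cover[OF r_in c_in] by simp
    finally show "sq_mat $$ (i, j) = (L * U) $$ (i, j)" using ij by (simp add: sq_mat_def)
  qed (simp_all add: L_def U_def)
  moreover have "zero_one_mat L" "zero_one_mat U"
    by (auto simp: zero_one_mat_iff L_def U_def)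
  moreover have "L \<in> carrier_mat (dim_row sq_mat) (card K)" "U \<in> carrier_mat (card K) (dim_col sq_mat)"
    by (auto simp: L_def U_def)
  ultimately have "binary_factorization sq_mat (card K)"
    unfolding binary_factorization_def by blast
  then show ?thesis unfolding binary_rank_def by (rule Least_le)
qed

lemma zero_cover:
  obtains P Q where
    "\<And>x y. x \<in> A \<Longrightarrow> y \<in> B \<Longrightarrow> \<not> R x y \<longleftrightarrow> (\<exists>l<boolean_rank (complement_mat sq_mat). x \<in> P l \<and> y \<in> Q l)"
proof -
  let ?k = "boolean_rank (complement_mat sq_mat)"
  have "zero_one_mat (complement_mat sq_mat)"
    by (auto simp: zero_one_mat_iff complement_mat_def sq_mat_def)
  from boolean_factorization_dim_row[OF this] have "boolean_factorization (complement_mat sq_mat) ?k"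
    unfolding boolean_rank_def by (rule LeastI)
  then obtain L U where L: "L \<in> carrier_mat (a * b) ?k" and U: "U \<in> carrier_mat ?k (a * b)"
    and LU: "complement_mat sq_mat = boolean_mult_mat L U"
    unfolding boolean_factorization_def by (auto simp: complement_mat_def)
  \<comment> \<open>The factors are read only at the first copy of each row and column, where
    injectivity of \<open>r\<close> and \<open>c\<close> makes the index of \<open>x\<close> and of
    \<open>y\<close> unique.\<close>
  show ?thesis
  proof (rule that[of "\<lambda>l. {x. \<exists>i<a. r i = x \<and> L $$ (i, l) = 1}" "\<lambda>l. {y. \<exists>j<b. c j = y \<and> U $$ (l, j) = 1}"])
    fix x y assume "x \<in> A" "y \<in> B"
    then obtain i j where ij: "i < a" "r i = x" "j < b" "c j = y"
      using r c by (fastforce simp: bij_betw_def)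
    then have ab: "i < a * b" "j < a * b" using pos
      by (metis Suc_leI less_le_trans mult_le_mono mult_1_right le_refl One_nat_def,
          metis Suc_leI less_le_trans mult_le_mono mult_1 le_refl One_nat_def)
    have "\<not> R x y \<longleftrightarrow> complement_mat sq_mat $$ (i, j) = 1"
      using ab ij by (simp add: complement_mat_def sq_mat_def)
    also have "\<dots> \<longleftrightarrow> (\<exists>l<?k. L $$ (i, l) = 1 \<and> U $$ (l, j) = 1)"
      using ab L U by (subst LU) (auto simp: boolean_mult_mat_def)
    also have "\<dots> \<longleftrightarrow> (\<exists>l<?k. x \<in> {x. \<exists>i<a. r i = x \<and> L $$ (i, l) = 1} \<and> y \<in> {y. \<exists>j<b. c j = y \<and> U $$ (l, j) = 1})"
    proof -
      have "i' = i" if "i' < a" "r i' = x" for i'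
        using r ij that by (auto simp: bij_betw_def inj_on_def)
      moreover have "j' = j" if "j' < b" "c j' = y" for j'
        using c ij that by (auto simp: bij_betw_def inj_on_def)
      ultimately show ?thesis using ij by blast
    qed
    finally show "\<not> R x y \<longleftrightarrow> (\<exists>l<?k. x \<in> {x. \<exists>i<a. r i = x \<and> L $$ (i, l) = 1} \<and> y \<in> {y. \<exists>j<b. c j = y \<and> U $$ (l, j) = 1})" .
  qed
qed

end

section \<open>The lifted matrix\<close>

lemma mod_shift:
  fixes a b q :: nat
  assumes "b < q"
  shows "((a + q - b) mod q + b) mod q = a mod q"
proof -
  have "((a + q - b) mod q + b) mod q = (a + q - b + b) mod q" by (simp add: mod_add_left_eq)
  then show ?thesis using assms by simp
qed

lemma mod_add_cancel:
  fixes a b s q :: nat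
  assumes "(a + s) mod q = (b + s) mod q" "a < q" "b < q"
  shows "a = b"
proof -
  have *: "c \<ge> d" if "(c + s) mod q = (d + s) mod q" "d < q" for c d
  proof (rule ccontr)
    assume "\<not> c \<ge> d"
    then have "q dvd (d + s) - (c + s)" using that(1) by (subst mod_eq_dvd_iff_nat[symmetric]) auto
    then have "q \<le> d - c" using \<open>\<not> c \<ge> d\<close> by (intro dvd_imp_le) auto
    then show False using that(2) by simp
  qed
  show ?thesis using *[of a b] *[of b a] assms by simp
qed

context unambiguous_dnf
begin

text \<open>The gadget looks up the word of a column at the pointer of a row and adds the shift of the
  row. The shift is there only to balance the columns, which makes the matrix regular.\<close>
definition lift_val :: "('i \<Rightarrow> nat \<times> nat) \<Rightarrow> ('i \<Rightarrow> nat \<Rightarrow> nat) \<Rightarrow> 'i \<Rightarrow> nat" where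
  "lift_val x y i = (y i (fst (x i)) + snd (x i)) mod q"

lemma sat_cong: "(\<And>i. i \<in> I \<Longrightarrow> z i = z' i) \<Longrightarrow> sat z = sat z'"
  unfolding sat_def using dm_subset by (metis subsetD)

text \<open>In every word the positions that \<open>x\<close> and \<open>x'\<close> point to are
  exchanged, and all letters are corrected by the difference of the shifts. The new column then has
  at \<open>x'\<close> the gadget values that the old one had at \<open>x\<close>. Used in both
  directions, this gives equal row sums.\<close>

lemma card_sat_row_le:
  assumes x: "x \<in> I \<rightarrow>\<^sub>E {..<m} \<times> {..<q}" and x': "x' \<in> I \<rightarrow>\<^sub>E {..<m} \<times> {..<q}"
  shows "card {y \<in> I \<rightarrow>\<^sub>E words m q. sat (lift_val x y)} \<le> card {y \<in> I \<rightarrow>\<^sub>E words m q. sat (lift_val x' y)}"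
proof (rule card_inj_on_le)
  define T where "T i = (\<lambda>a. if a = fst (x i) then fst (x' i) else if a = fst (x' i) then fst (x i) else a)" for i
  have T: "T i (T i a) = a" "T i (fst (x' i)) = fst (x i)" for i a
    by (auto simp: T_def)
  have xm: "fst (x i) < m" "snd (x i) < q" "fst (x' i) < m" "snd (x' i) < q" if "i \<in> I" for i
    using x x' that by (auto simp: PiE_iff mem_Times_iff)
  have Tm: "T i a < m" if "i \<in> I" "a < m" for i a
    using that xm[OF that(1)] by (auto simp: T_def)
  \<comment> \<open>Adding \<open>q\<close> before subtracting keeps the difference of naturals from
    being truncated.\<close>
  define f where "f y = (\<lambda>i\<in>I. \<lambda>a\<in>{..<m}. (y i (T i a) + snd (x i) + q - snd (x' i)) mod q)" for y
  show "inj_on f {y \<in> I \<rightarrow>\<^sub>E words m q. sat (lift_val x y)}"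
  proof (rule inj_onI)
    fix y y' assume y: "y \<in> {y \<in> I \<rightarrow>\<^sub>E words m q. sat (lift_val x y)}"
      and y': "y' \<in> {y \<in> I \<rightarrow>\<^sub>E words m q. sat (lift_val x y)}" and e: "f y = f y'"
    have "y i a = y' i a" if i: "i \<in> I" and a: "a < m" for i a
    proof -
      have "f y i (T i a) = f y' i (T i a)" using e by simp
      then have "(y i a + snd (x i) + q - snd (x' i)) mod q = (y' i a + snd (x i) + q - snd (x' i)) mod q"
        using i a Tm[OF i a] by (simp add: f_def T)
      moreover have "u + snd (x i) + q - snd (x' i) = u + (snd (x i) + q - snd (x' i))" for u
        using xm[OF i] by simp
      ultimately have "(y i a + (snd (x i) + q - snd (x' i))) mod q = (y' i a + (snd (x i) + q - snd (x' i))) mod q"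
        by (simp only:)
      then show ?thesis
        by (rule mod_add_cancel) (use y y' i a in \<open>auto simp: words_def PiE_iff\<close>)
    qed
    then have "y i = y' i" if "i \<in> I" for i
      using y y' that by (intro extensionalityI[of _ "{..<m}"]) (auto simp: words_def PiE_iff)
    then show "y = y'" using y y' by (intro extensionalityI[of _ I]) (auto simp: PiE_iff)
  qed
  show "f ` {y \<in> I \<rightarrow>\<^sub>E words m q. sat (lift_val x y)} \<subseteq> {y \<in> I \<rightarrow>\<^sub>E words m q. sat (lift_val x' y)}"
  proof (rule image_subsetI)
    fix y assume y: "y \<in> {y \<in> I \<rightarrow>\<^sub>E words m q. sat (lift_val x y)}"
    have "f y \<in> I \<rightarrow>\<^sub>E words m q"
    proof -
      have "(y i (T i a) + snd (x i) + q - snd (x' i)) mod q < q" if "i \<in> I" for i a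
        using xm(2)[OF that] by simp
      then show ?thesis by (auto simp: f_def words_def)
    qed
    moreover have "lift_val x' (f y) i = lift_val x y i" if i: "i \<in> I" for i
      using xm[OF i] i by (simp add: lift_val_def f_def T mod_shift)
    then have "sat (lift_val x' (f y))" using y sat_cong[of "lift_val x' (f y)" "lift_val x y"] by simp
    ultimately show "f y \<in> {y \<in> I \<rightarrow>\<^sub>E words m q. sat (lift_val x' y)}" by simp
  qed
  show "finite {y \<in> I \<rightarrow>\<^sub>E words m q. sat (lift_val x' y)}"
    using finite_I by (auto intro!: finite_PiE finite_words)
qed

text \<open>The pointers stay, and each shift absorbs the difference of the two words at its
  pointer.\<close>

lemma card_sat_col_le:
  assumes y: "y \<in> I \<rightarrow>\<^sub>E words m q" and y': "y' \<in> I \<rightarrow>\<^sub>E words m q"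
  shows "card {x \<in> I \<rightarrow>\<^sub>E {..<m} \<times> {..<q}. sat (lift_val x y)} \<le> card {x \<in> I \<rightarrow>\<^sub>E {..<m} \<times> {..<q}. sat (lift_val x y')}"
proof (rule card_inj_on_le)
  define f where "f x = (\<lambda>i\<in>I. (fst (x i), (y i (fst (x i)) + snd (x i) + q - y' i (fst (x i))) mod q))" for x
  have yq: "y i a < q" "y' i a < q" if "i \<in> I" "a < m" for i a
    using y y' that by (auto simp: PiE_iff words_def)
  show "inj_on f {x \<in> I \<rightarrow>\<^sub>E {..<m} \<times> {..<q}. sat (lift_val x y)}"
  proof (rule inj_onI)
    fix x x' assume x: "x \<in> {x \<in> I \<rightarrow>\<^sub>E {..<m} \<times> {..<q}. sat (lift_val x y)}"
      and x': "x' \<in> {x \<in> I \<rightarrow>\<^sub>E {..<m} \<times> {..<q}. sat (lift_val x y)}" and e: "f x = f x'"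
    have "x i = x' i" if i: "i \<in> I" for i
    proof -
      have xm: "fst (x i) < m" "snd (x i) < q" "snd (x' i) < q"
        using x x' i by (auto simp: PiE_iff mem_Times_iff)
      let ?c = "y i (fst (x i)) + q - y' i (fst (x i))"
      have "f x i = f x' i" using e by simp
      then have *: "fst (x i) = fst (x' i)" "(snd (x i) + ?c) mod q = (snd (x' i) + ?c) mod q"
        using i yq[OF i xm(1)] by (auto simp: f_def ac_simps)
      have "snd (x i) = snd (x' i)" by (rule mod_add_cancel[OF *(2)]) (rule xm)+
      then show ?thesis using * by (simp add: prod_eq_iff)
    qed
    then show "x = x'" using x x' by (intro extensionalityI[of _ I]) (auto simp: PiE_iff)
  qed
  show "f ` {x \<in> I \<rightarrow>\<^sub>E {..<m} \<times> {..<q}. sat (lift_val x y)} \<subseteq> {x \<in> I \<rightarrow>\<^sub>E {..<m} \<times> {..<q}. sat (lift_val x y')}"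
  proof (rule image_subsetI)
    fix x assume x: "x \<in> {x \<in> I \<rightarrow>\<^sub>E {..<m} \<times> {..<q}. sat (lift_val x y)}"
    have xm: "fst (x i) < m" "snd (x i) < q" if "i \<in> I" for i
      using x that by (auto simp: PiE_iff mem_Times_iff)
    have "f x \<in> I \<rightarrow>\<^sub>E {..<m} \<times> {..<q}"
    proof -
      have "(y i (fst (x i)) + snd (x i) + q - y' i (fst (x i))) mod q < q" if "i \<in> I" for i
        using xm(2)[OF that] by simp
      then show ?thesis using xm by (auto simp: f_def)
    qed
    moreover have "lift_val (f x) y' i = lift_val x y i" if i: "i \<in> I" for i
      using i yq[OF i xm(1)[OF i]] mod_shift[of "y' i (fst (x i))" q "y i (fst (x i)) + snd (x i)"]
      by (simp add: lift_val_def f_def add.commute)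
    then have "sat (lift_val (f x) y')" using x sat_cong[of "lift_val (f x) y'" "lift_val x y"] by simp
    ultimately show "f x \<in> {x \<in> I \<rightarrow>\<^sub>E {..<m} \<times> {..<q}. sat (lift_val x y')}" by simp
  qed
  show "finite {x \<in> I \<rightarrow>\<^sub>E {..<m} \<times> {..<q}. sat (lift_val x y')}"
    using finite_I by (simp add: finite_PiE)
qed

text \<open>A one of the lifted matrix determines its certificate \<open>c\<close> and the pointers and shifts used
  by \<open>c\<close>, and the ones with the same such data form a rectangle.\<close>
lemma card_rectangles_through:
  assumes x: "x \<in> I \<rightarrow>\<^sub>E {..<m} \<times> {..<q}"
  shows "card {k \<in> Sigma Cs (\<lambda>c. dm c \<rightarrow>\<^sub>E {..<m} \<times> {..<q}).
      x \<in> {x. \<forall>i\<in>dm (fst k). x i = snd k i} \<and>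
      y \<in> {y. \<forall>i\<in>dm (fst k). (y i (fst (snd k i)) + snd (snd k i)) mod q = vl (fst k) i}}
    = (if sat (lift_val x y) then 1 else 0)" (is "card ?K = _")
proof (cases "sat (lift_val x y)")
  case True
  then obtain c where c: "c \<in> Cs" "\<And>i. i \<in> dm c \<Longrightarrow> lift_val x y i = vl c i"
    unfolding sat_def by blast
  have "?K = {(c, restrict x (dm c))}"
  proof (intro equalityI subsetI)
    fix k assume k: "k \<in> ?K"
    obtain c' p where cp: "k = (c', p)" by (cases k)
    have p: "c' \<in> Cs" "p \<in> dm c' \<rightarrow>\<^sub>E {..<m} \<times> {..<q}" "\<And>i. i \<in> dm c' \<Longrightarrow> x i = p i"
        "\<And>i. i \<in> dm c' \<Longrightarrow> lift_val x y i = vl c' i"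
      using k by (auto simp: cp lift_val_def)
    have "c' = c"
    proof (rule ccontr)
      assume "c' \<noteq> c"
      then obtain i where "i \<in> dm c' \<inter> dm c" "vl c' i \<noteq> vl c i" using conflict[OF p(1) c(1)] by blast
      then show False using p(4)[of i] c(2)[of i] by simp
    qed
    moreover have "p = restrict x (dm c')"
      using p(2,3) by (intro extensionalityI[of _ "dm c'"]) (auto simp: PiE_iff)
    ultimately show "k \<in> {(c, restrict x (dm c))}" by (simp add: cp)
  next
    fix k assume "k \<in> {(c, restrict x (dm c))}"
    moreover have "restrict x (dm c) \<in> dm c \<rightarrow>\<^sub>E {..<m} \<times> {..<q}"
      using x dm_subset[OF c(1)] by (auto simp: PiE_iff)
    ultimately show "k \<in> ?K" using c by (auto simp: lift_val_def)
  qed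
  then show ?thesis using True by simp
next
  case False
  have "?K = {}"
  proof (rule ccontr)
    assume "?K \<noteq> {}"
    then obtain k where k: "k \<in> ?K" by blast
    then have "lift_val x y i = vl (fst k) i" if "i \<in> dm (fst k)" for i
      using that by (auto simp: lift_val_def)
    then have "\<forall>i\<in>dm (fst k). lift_val x y i = vl (fst k) i" by blast
    moreover have "fst k \<in> Cs" using k by auto
    ultimately have "sat (lift_val x y)" unfolding sat_def by blast
    then show False using False by simp
  qed
  then show ?thesis using False by (simp only: card.empty if_False)
qed

text \<open>A rectangle of ones is labelled by a certificate with a pointer and a shift for each of
  its at most \<open>w\<close> variables. For the cover, the entries over \<open>z\<close> are
  zeros, and no zero rectangle holds more than a \<open>1 / k ^ C\<close> fraction of them.\<close>

theorem lifted_matrix: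
  assumes z: "\<And>i. i \<in> I \<Longrightarrow> z i < q" and nz: "\<not> sat z" and rob: "robust z C"
    and w: "\<And>c. c \<in> Cs \<Longrightarrow> card (dm c) \<le> w" "w \<ge> 1"
    and k: "k \<ge> 2" "m = k\<^sup>2" and q: "q \<ge> 1"
    and small: "real w * ((2 * real m) ^ w + 1) * exp (- real k / (512 * (real w)\<^sup>2 * real q))
      * real q ^ card I * real k ^ (2 * C) \<le> 1"
  obtains M where "square_mat M" "regular_mat M" "binary_rank M \<le> card Cs * (m * q) ^ w"
    "k ^ C \<le> boolean_rank (complement_mat M)"
proof -
  let ?A = "I \<rightarrow>\<^sub>E {..<m} \<times> {..<q}" and ?B = "I \<rightarrow>\<^sub>E words m q"
  let ?R = "\<lambda>x y. sat (lift_val x y)"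
  have m: "m \<ge> 1" using k by simp
  have fin: "finite ?A" "finite ?B" using finite_I by (auto intro!: finite_PiE finite_words)
  have pos: "card ?A > 0" "card ?B > 0"
    using finite_I m q by (simp_all add: card_PiE card_words card_cartesian_product)
  then have ne: "?A \<noteq> {}" "?B \<noteq> {}" by auto
  obtain r where r: "bij_betw r {..<card ?A} ?A"
    using ex_bij_betw_nat_finite[OF fin(1)] by (auto simp: atLeast0LessThan)
  obtain c where c: "bij_betw c {..<card ?B} ?B"
    using ex_bij_betw_nat_finite[OF fin(2)] by (auto simp: atLeast0LessThan)
  interpret L: finite_relation ?A ?B ?R r c "card ?A" "card ?B"
    using r c pos by unfold_locales
  have reg: "regular_mat L.sq_mat"
  proof -
    obtain x0 y0 where "x0 \<in> ?A" "y0 \<in> ?B" using ne by blast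
    then show ?thesis
      by (intro L.regular_sq_mat[of "card {y \<in> ?B. ?R x0 y}" "card {x \<in> ?A. ?R x y0}"])
         (auto intro!: antisym card_sat_row_le card_sat_col_le)
  qed
  have "binary_rank L.sq_mat \<le> card (Sigma Cs (\<lambda>c. dm c \<rightarrow>\<^sub>E {..<m} \<times> {..<q}))"
  proof (rule L.binary_rank_sq_mat_le)
    show "finite (Sigma Cs (\<lambda>c. dm c \<rightarrow>\<^sub>E {..<m} \<times> {..<q}))"
      using finite_Cs finite_subset[OF dm_subset finite_I] by (intro finite_SigmaI finite_PiE) auto
  qed (rule card_rectangles_through)
  also have "\<dots> = (\<Sum>c\<in>Cs. card (dm c \<rightarrow>\<^sub>E {..<m} \<times> {..<q}))"
    using finite_Cs finite_subset[OF dm_subset finite_I] by (intro card_SigmaI ballI finite_PiE) auto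
  also have "\<dots> \<le> (\<Sum>c\<in>Cs. (m * q) ^ w)"
  proof (rule sum_mono)
    fix c assume c: "c \<in> Cs"
    have "card (dm c \<rightarrow>\<^sub>E {..<m} \<times> {..<q}) = (m * q) ^ card (dm c)"
      using finite_subset[OF dm_subset[OF c] finite_I] by (simp add: card_PiE card_cartesian_product)
    also have "\<dots> \<le> (m * q) ^ w" using w(1)[OF c] m q by (intro power_increasing) auto
    finally show "card (dm c \<rightarrow>\<^sub>E {..<m} \<times> {..<q}) \<le> (m * q) ^ w" .
  qed
  finally have bin: "binary_rank L.sq_mat \<le> card Cs * (m * q) ^ w" by simp
  have "k ^ C \<le> boolean_rank (complement_mat L.sq_mat)"
  proof -
    let ?b = "boolean_rank (complement_mat L.sq_mat)"
    let ?X = "I \<rightarrow>\<^sub>E {..<m}" and ?w0 = "q ^ ((m - 1) * card I)"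
    obtain P Q where PQ: "\<And>x y. x \<in> ?A \<Longrightarrow> y \<in> ?B \<Longrightarrow> \<not> ?R x y \<longleftrightarrow> (\<exists>l<?b. x \<in> P l \<and> y \<in> Q l)"
      using L.zero_cover by metis
    \<comment> \<open>The rows with all shifts \<open>0\<close> carry the plain index gadget, to
      which \<open>rectangle_bound\<close> applies.\<close>
    define e where "e x = (\<lambda>i\<in>I. (x i, 0 :: nat))" for x :: "'i \<Rightarrow> nat"
    have e: "e x \<in> ?A" if "x \<in> ?X" for x using that q by (auto simp: e_def PiE_iff)
    have val: "lift_val (e x) y i = y i (x i)" if "x \<in> ?X" "y \<in> ?B" "i \<in> I" for x y i
      using that by (auto simp: lift_val_def e_def PiE_iff words_def)
    have Re: "?R (e x) y \<longleftrightarrow> sat (\<lambda>i. y i (x i))" if "x \<in> ?X" "y \<in> ?B" for x y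
      using that val by (intro sat_cong) auto
    let ?T = "\<lambda>l. {(x, y). x \<in> {x \<in> ?X. e x \<in> P l} \<and> y \<in> ?B \<inter> Q l \<and> (\<forall>i\<in>I. y i (x i) = z i)}"
    have T: "card (?T l) * k ^ C \<le> m ^ card I * ?w0" if l: "l < ?b" for l
    proof (rule rectangle_bound[OF _ _ _ z rob w k q small])
      fix x y assume xy: "x \<in> {x \<in> ?X. e x \<in> P l}" "y \<in> ?B \<inter> Q l"
      then have "\<not> ?R (e x) y" using PQ[of "e x" y] e[of x] l by blast
      then show "\<not> sat (\<lambda>i. y i (x i))" using Re xy by auto
    qed auto
    have sub: "Sigma ?X (\<lambda>x. {y \<in> ?B. \<forall>i\<in>I. y i (x i) = z i}) \<subseteq> (\<Union>l<?b. ?T l)"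
    proof
      fix u assume "u \<in> Sigma ?X (\<lambda>x. {y \<in> ?B. \<forall>i\<in>I. y i (x i) = z i})"
      then obtain x y where u: "u = (x, y)" "x \<in> ?X" "y \<in> ?B" "\<And>i. i \<in> I \<Longrightarrow> y i (x i) = z i" by auto
      then have "\<not> sat (\<lambda>i. y i (x i))" using nz sat_cong[of "\<lambda>i. y i (x i)" z] by simp
      then have "\<not> ?R (e x) y" using Re u by simp
      then obtain l where "l < ?b" "e x \<in> P l" "y \<in> Q l" using PQ[OF e[OF u(2)] u(3)] by blast
      then show "u \<in> (\<Union>l<?b. ?T l)" using u by auto
    qed
    have finT: "finite (?T l)" for l
      by (rule finite_subset[of _ "?X \<times> ?B"]) (use finite_I fin in \<open>auto intro: finite_PiE\<close>)
    have "card (Sigma ?X (\<lambda>x. {y \<in> ?B. \<forall>i\<in>I. y i (x i) = z i})) = (\<Sum>x\<in>?X. card {y \<in> ?B. \<forall>i\<in>I. y i (x i) = z i})"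
      using finite_I fin by (intro card_SigmaI) (auto intro!: finite_PiE)
    also have "\<dots> = (\<Sum>x\<in>?X. ?w0)"
      using z finite_I by (intro sum.cong card_words_through) auto
    also have "\<dots> = m ^ card I * ?w0" using finite_I by (simp add: card_PiE)
    finally have "m ^ card I * ?w0 \<le> card (\<Union>l<?b. ?T l)"
      using card_mono[OF _ sub] finT by simp
    also have "\<dots> \<le> (\<Sum>l<?b. card (?T l))" by (intro card_UN_le) simp
    finally have "m ^ card I * ?w0 * k ^ C \<le> (\<Sum>l<?b. card (?T l)) * k ^ C" by (rule mult_right_mono) simp
    also have "\<dots> = (\<Sum>l<?b. card (?T l) * k ^ C)" by (rule sum_distrib_right)
    also have "\<dots> \<le> (\<Sum>l<?b. m ^ card I * ?w0)" using T by (intro sum_mono) simp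
    also have "\<dots> = m ^ card I * ?w0 * ?b" by simp
    finally show ?thesis using m q by simp
  qed
  then show ?thesis using that[of L.sq_mat] reg bin by (simp add: square_mat.simps)
qed

end

section \<open>Choice of the parameters\<close>

lemma sum_power_le: "(\<Sum>i\<le>n. (4::nat) ^ i) \<le> 4 ^ (n + 1)"
  by (induction n) auto

lemma finite_paths: "finite {v :: (bool \<times> bool) list. length v \<le> n}"
  using finite_lists_length_le[of "UNIV :: (bool \<times> bool) set" n] by simp

lemma card_paths_le: "card {v :: (bool \<times> bool) list. length v \<le> n} \<le> 4 ^ (n + 1)"
proof -
  have "card (UNIV :: (bool \<times> bool) set) = 4" by (simp flip: UNIV_Times_UNIV add: card_cartesian_product)
  then show ?thesis
    using card_lists_length_le[of "UNIV :: (bool \<times> bool) set" n] sum_power_le[of n] by simp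
qed

lemma exp_neg_le_two_powr:
  fixes x :: real
  assumes "x \<ge> 0"
  shows "exp (- x) \<le> 2 powr (- x)"
proof -
  have "2 powr (- x) = exp (- x * ln 2)" by (simp add: powr_def)
  moreover have "x * ln 2 \<le> x * 1" using assms ln_2_less_1 by (intro mult_left_mono) auto
  ultimately show ?thesis by simp
qed

text \<open>The exponential is at most \<open>2 powr (- (2 ^ (33 * P)))\<close>: the denominator
  takes at most \<open>27 * P\<close> bits and \<open>60 = 33 + 27\<close>. The remaining factors
  multiply to at most \<open>2 ^ e\<close> with \<open>e\<close> below
  \<open>2 ^ (33 * P)\<close>.\<close>

lemma small_failure:
  fixes P w n q C k m :: nat
  assumes P: "P \<ge> 2" and w: "1 \<le> w" "w \<le> 2 ^ (6 * P)" and n: "n \<le> 2 ^ (8 * P)"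
    and q: "1 \<le> q" "q \<le> 2 ^ (6 * P)" and C: "C \<le> 2 ^ (2 * P)" and k: "k = 2 ^ (60 * P)" and m: "m = 2 ^ (120 * P)"
  shows "real w * ((2 * real m) ^ w + 1) * exp (- real k / (512 * (real w)\<^sup>2 * real q))
      * real q ^ n * real k ^ (2 * C) \<le> 1"
proof -
  let ?x = "real k / (512 * (real w)\<^sup>2 * real q)"
  have P2: "P \<le> 2 ^ P" using less_exp[of P] by simp
  have x: "2 ^ (33 * P) \<le> ?x"
  proof -
    have "512 * w\<^sup>2 * q \<le> 2 ^ (9 * P) * (2 ^ (6 * P))\<^sup>2 * 2 ^ (6 * P)"
    proof (intro mult_mono power_mono)
      have "(2::nat) ^ 9 \<le> 2 ^ (9 * P)" using P by (intro power_increasing) auto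
      then show "512 \<le> (2::nat) ^ (9 * P)" by simp
    qed (use w q in auto)
    also have "\<dots> = 2 ^ (27 * P)" by (simp flip: power_add power_mult)
    finally have "real (512 * w\<^sup>2 * q) \<le> real (2 ^ (27 * P))" by (simp only: of_nat_le_iff)
    then have "2 ^ (33 * P) * (512 * (real w)\<^sup>2 * real q) \<le> 2 ^ (33 * P) * 2 ^ (27 * P)"
      by (intro mult_left_mono) auto
    also have "\<dots> = real k" using k by (simp flip: power_add)
    finally show ?thesis using w q by (simp add: pos_le_divide_eq)
  qed
  define e where "e = 6 * P + ((120 * P + 1) * w + 1) + 6 * P * n + 60 * P * (2 * C)"
  have e: "e \<le> 2 ^ (33 * P)"
  proof -
    let ?Z = "(2::nat) ^ (9 * P)"
    have up: "(2::nat) ^ i \<le> ?Z" if "i \<le> 9 * P" for i using that by (intro power_increasing) auto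
    have "P * w \<le> 2 ^ P * 2 ^ (6 * P)" "P * n \<le> 2 ^ P * 2 ^ (8 * P)" "P * C \<le> 2 ^ P * 2 ^ (2 * P)"
      using P2 w n C by (auto intro!: mult_mono)
    then have "P * w \<le> 2 ^ (7 * P)" "P * n \<le> ?Z" "P * C \<le> 2 ^ (3 * P)"
      by (simp_all flip: power_add)
    then have "P * w \<le> ?Z" "P * n \<le> ?Z" "P * C \<le> ?Z"
      by (auto intro: le_trans[OF _ up])
    moreover have "P \<le> ?Z" by (rule le_trans[OF P2 up]) simp
    moreover have "w \<le> ?Z" by (rule le_trans[OF w(2) up]) simp
    moreover have "1 \<le> ?Z" by simp
    moreover have "e = 6 * P + 120 * (P * w) + w + 1 + 6 * (P * n) + 120 * (P * C)"
      by (simp add: e_def algebra_simps)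
    \<comment> \<open>The coefficients in the expansion of \<open>e\<close> add up to
      \<open>254\<close>.\<close>
    ultimately have "e \<le> 255 * ?Z" by linarith
    also have "255 * ?Z \<le> 2 ^ (8 * P) * ?Z"
    proof (rule mult_right_mono)
      have "(2::nat) ^ 8 \<le> 2 ^ (8 * P)" using P by (intro power_increasing) auto
      then show "255 \<le> (2::nat) ^ (8 * P)" by simp
    qed simp
    also have "\<dots> \<le> 2 ^ (33 * P)" by (simp flip: power_add)
    finally show ?thesis .
  qed
  have "exp (- ?x) \<le> 2 powr (- ?x)" using w q k by (intro exp_neg_le_two_powr) auto
  also have "\<dots> \<le> 2 powr (- real e)"
  proof -
    have "real e \<le> 2 ^ (33 * P)" using e by (metis of_nat_le_iff of_nat_numeral of_nat_power)
    then have "real e \<le> ?x" using x by (rule order_trans)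
    then show ?thesis by simp
  qed
  also have "\<dots> = 1 / 2 ^ e" by (simp add: powr_minus powr_realpow field_simps)
  finally have ex: "exp (- ?x) \<le> 1 / 2 ^ e" .
  have "real w * ((2 * real m) ^ w + 1) * real q ^ n * real k ^ (2 * C)
      \<le> 2 ^ (6 * P) * 2 ^ ((120 * P + 1) * w + 1) * 2 ^ (6 * P * n) * 2 ^ (60 * P * (2 * C))"
  proof (intro mult_mono)
    show "real w \<le> 2 ^ (6 * P)" using w(2) by (metis of_nat_le_iff of_nat_numeral of_nat_power)
    have "(2 * real m) ^ w = 2 ^ ((120 * P + 1) * w)"
      using m by (simp flip: power_mult power_Suc)
    then show "(2 * real m) ^ w + 1 \<le> 2 ^ ((120 * P + 1) * w + 1)" by simp
    have "real q \<le> 2 ^ (6 * P)" using q(2) by (metis of_nat_le_iff of_nat_numeral of_nat_power)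
    then have "real q ^ n \<le> (2 ^ (6 * P)) ^ n" by (intro power_mono) auto
    then show "real q ^ n \<le> 2 ^ (6 * P * n)" by (simp add: power_mult)
    show "real k ^ (2 * C) \<le> 2 ^ (60 * P * (2 * C))"
      by (simp only: k of_nat_power of_nat_numeral power_mult order_refl)
  qed auto
  also have "\<dots> = 2 ^ e" by (simp add: e_def power_add)
  finally have "real w * ((2 * real m) ^ w + 1) * real q ^ n * real k ^ (2 * C) * exp (- ?x) \<le> 2 ^ e * (1 / 2 ^ e)"
    using ex by (intro mult_mono) auto
  then show ?thesis by (simp add: ac_simps)
qed

text \<open>Deleting up to \<open>4 ^ p\<close> cells yields edges of size about
  \<open>p * 2 ^ p\<close>, so up to powers of \<open>p\<close> the exponents of the two bounds are
  a number and its square.\<close>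

lemma gap_matrix:
  assumes p: "p \<ge> 1"
  obtains M where "square_mat M" "regular_mat M"
    "binary_rank M \<le> 2 ^ (6240 * (p + 1) ^ 3 * 2 ^ p)" "2 ^ 4 ^ p \<le> boolean_rank (complement_mat M)"
proof -
  define P where "P = p + 1"
  \<comment> \<open>The least \<open>t\<close> with \<open>4 ^ p < 2 ^ t\<close>. It serves as depth
    of the game tree and as number of copies, which both need this inequality.\<close>
  define t where "t = 2 * p + 1"
  \<comment> \<open>The bound of \<open>card_cert\<close>, since
    \<open>sqrt (4 ^ p) = 2 ^ p\<close>.\<close>
  define r where "r = 2 + 4 * t * 2 ^ p"
  define V where "V = (UNIV :: bool set) \<times> {v :: (bool \<times> bool) list. length v \<le> t}"
  define E where "E s = {cert s t A | A. finite A \<and> card A \<le> 4 ^ p}" for s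
  define q where "q = card V + 1"
  have h: "(4::nat) ^ p < 2 ^ t" by (simp add: t_def power_mult)
  have finV: "finite V" unfolding V_def using finite_paths by (intro finite_cartesian_product) auto
  obtain f where f: "bij_betw f V {0..<card V}" using ex_bij_betw_finite_nat[OF finV] by blast
  have "(True, []) \<in> V" by (simp add: V_def)
  then have V1: "card V \<ge> 1" using finV by (metis One_nat_def Suc_leI card_gt_0_iff empty_iff)
  interpret hypergraph_pair V E r "4 ^ p" t q "\<lambda>v. Suc (f v)"
  proof
    fix e s assume "e \<in> E s"
    then obtain A where A: "e = cert s t A" "finite A" "card A \<le> 4 ^ p" by (auto simp: E_def)
    have "e \<subseteq> V" using cert_length by (force simp: A(1) V_def)
    moreover have "card e \<le> r"
    proof -
      have "sqrt (card A) \<le> sqrt (4 ^ p)"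
        using A(3) by (metis of_nat_le_iff of_nat_numeral of_nat_power real_sqrt_le_mono)
      also have "\<dots> = 2 ^ p" by (simp add: real_sqrt_power)
      finally have "4 * real t * sqrt (card A) \<le> 4 * real t * 2 ^ p" by (intro mult_left_mono) auto
      then have "real (card e) \<le> real r" using card_cert[OF A(2), of s t] by (simp add: A(1) r_def)
      then show ?thesis by simp
    qed
    ultimately show "e \<subseteq> V \<and> e \<noteq> {} \<and> card e \<le> r" using cert_nonempty by (auto simp: A(1))
  next
    fix e e' assume "e \<in> E True" "e' \<in> E False"
    then obtain A B where A: "e = cert True t A" "finite A" "card A \<le> 4 ^ p" and B: "e' = cert False t B"
      unfolding E_def by blast
    then show "e \<inter> e' \<noteq> {}" using cert_intersect[OF A(2), of t B] h by simp
  next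
    fix A :: "(bool \<times> bool) list set" and s assume "finite A" "card A \<le> 4 ^ p"
    then show "\<exists>e\<in>E s. \<forall>a\<in>A. (s, a) \<notin> e"
      using cert_avoids by (intro bexI[of _ "cert s t A"]) (auto simp: E_def)
  next
    show "inj_on (\<lambda>v. Suc (f v)) V" using f by (auto simp: bij_betw_def inj_on_def)
    show "(\<lambda>v. Suc (f v)) ` V \<subseteq> {1..<q}" using f by (fastforce simp: bij_betw_def q_def)
  qed (use finV V1 h in \<open>auto simp: q_def t_def\<close>)

  have P: "P \<ge> 2" using p by (simp add: P_def)
  have pP: "P \<le> 2 ^ p" using Suc_leI[OF less_exp[of p]] unfolding P_def by (simp only: Suc_eq_plus1)
  have tP: "t \<le> 2 ^ P" using pP by (simp add: t_def P_def)
  have rP: "r \<le> 2 ^ (4 * P)"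
  proof -
    have "r \<le> 2 + 4 * 2 ^ P * 2 ^ p" unfolding r_def using tP by (intro add_left_mono mult_right_mono mult_left_mono) auto
    also have "\<dots> = 2 ^ 1 + 2 ^ (2 * P + 1)"
    proof -
      have "2 * P + 1 = 2 + P + p" by (simp add: P_def)
      then show ?thesis by (simp only: power_add) simp
    qed
    also have "\<dots> \<le> 2 ^ (2 * P + 1) + 2 ^ (2 * P + 1)" by (intro add_right_mono power_increasing) auto
    also have "\<dots> = 2 ^ (2 * P + 2)" by simp
    also have "\<dots> \<le> 2 ^ (4 * P)" using P by (intro power_increasing) auto
    finally show ?thesis .
  qed
  have qP: "q \<le> 2 ^ (6 * P)"
  proof -
    have "card V \<le> 2 * 4 ^ (t + 1)"
      using card_paths_le[of t] by (simp add: V_def card_cartesian_product)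
    then have "q \<le> 2 * 4 ^ (t + 1) + 1" by (simp add: q_def)
    also have "\<dots> \<le> 4 ^ (t + 2)" by simp
    also have "\<dots> = 2 ^ (2 * (t + 2))" by (simp only: power_mult) simp
    also have "\<dots> \<le> 2 ^ (6 * P)" using P by (intro power_increasing) (auto simp: t_def P_def)
    finally show ?thesis .
  qed
  define w where "w = 2 * (t * r)"
  have tr: "t * r \<le> 2 ^ (5 * P)"
    using mult_mono[OF tP rP] by (simp flip: power_add)
  have w1: "w \<ge> 1" by (simp add: w_def t_def r_def)
  have wP: "w \<le> 2 ^ (6 * P)"
  proof -
    have "w \<le> 2 ^ 1 * 2 ^ (5 * P)" using tr by (simp add: w_def)
    also have "\<dots> \<le> 2 ^ (6 * P)" using P unfolding power_add[symmetric] by (intro power_increasing) auto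
    finally show ?thesis .
  qed
  have nP: "card (sheet_vars V t r) \<le> 2 ^ (8 * P)"
  proof -
    have "t * card V \<le> 2 ^ P * 2 ^ (6 * P)" using tP qP by (intro mult_mono) (auto simp: q_def)
    moreover have "2 ^ t * (t * r) \<le> 2 ^ (2 * P) * 2 ^ (5 * P)"
      using tr by (intro mult_mono power_increasing) (auto simp: t_def P_def)
    ultimately have "card (sheet_vars V t r) \<le> 2 ^ (7 * P) + 2 ^ (7 * P)"
      unfolding card_sheet_vars by (simp flip: power_add)
    also have "\<dots> = 2 ^ (7 * P + 1)" by simp
    also have "\<dots> \<le> 2 ^ (8 * P)" using P by (intro power_increasing) auto
    finally show ?thesis .
  qed
  define k :: nat where "k = 2 ^ (60 * P)"
  define m :: nat where "m = 2 ^ (120 * P)"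
  have C: "(4::nat) ^ p \<le> 2 ^ (2 * P)" by (simp add: P_def power_mult)
  have k2: "k \<ge> 2" "m = k\<^sup>2"
    using P power_increasing[of 1 "60 * P" "2::nat"] by (simp_all add: k_def m_def flip: power_mult)
  have q1: "q \<ge> 1" by (simp add: q_def)
  obtain M where M: "square_mat M" "regular_mat M"
      "binary_rank M \<le> card (sheet_certs V E t r) * (m * q) ^ w" "k ^ 4 ^ p \<le> boolean_rank (complement_mat M)"
    using lifted_matrix[OF blank_less not_sat_blank robust_blank, of w k m]
      small_failure[OF P w1 wP nP q1 qP C k_def m_def] card_sheet_dom w1 k2 q1
    unfolding w_def by metis
  have "binary_rank M \<le> 2 ^ (6240 * P ^ 3 * 2 ^ p)"
  proof -
    have "card (sheet_certs V E t r) \<le> 2 ^ t * card V ^ (t * r)" by (rule card_sheet_certs)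
    also have "\<dots> \<le> 2 ^ t * (2 ^ (6 * P)) ^ (t * r)"
      using qP by (intro mult_left_mono power_mono) (auto simp: q_def)
    finally have "card (sheet_certs V E t r) * (m * q) ^ w
        \<le> (2 ^ t * (2 ^ (6 * P)) ^ (t * r)) * (2 ^ (120 * P) * 2 ^ (6 * P)) ^ w"
      using qP by (intro mult_mono power_mono) (auto simp: m_def)
    also have "\<dots> = 2 ^ (t + 6 * P * (t * r) + 126 * P * w)"
      by (simp flip: power_add power_mult)
    also have "\<dots> \<le> 2 ^ (6240 * P ^ 3 * 2 ^ p)"
    proof (rule power_increasing)
      \<comment> \<open>With \<open>w = 2 * (t * r)\<close> the three terms contribute at most
        \<open>1 + 6 + 252 \<le> 260\<close> times \<open>P * (t * r)\<close>. Then
        \<open>6240 = 260 * 2 * 12\<close>, from the bounds on \<open>t\<close> and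
        \<open>r\<close>.\<close>
      have tP': "t \<le> 2 * P" by (simp add: t_def P_def)
      have "1 * 1 \<le> t * 2 ^ p" by (rule mult_le_mono) (simp_all add: t_def)
      then have "r \<le> 6 * t * 2 ^ p" by (simp add: r_def)
      also have "\<dots> \<le> 12 * P * 2 ^ p" using tP' by simp
      finally have r': "r \<le> 12 * P * 2 ^ p" .
      have "1 * 1 \<le> P * r" by (rule mult_le_mono) (use P in \<open>simp_all add: r_def\<close>)
      then have "t * 1 \<le> t * (P * r)" by (intro mult_le_mono2) simp
      then have "t \<le> P * (t * r)" by (simp add: ac_simps)
      then have "t + 6 * P * (t * r) + 126 * P * w \<le> 260 * P * (t * r)"
        by (simp add: w_def)
      also have "\<dots> \<le> 260 * P * (2 * P * (12 * P * 2 ^ p))"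
        using tP' r' by (intro mult_left_mono mult_mono) auto
      also have "\<dots> = 6240 * P ^ 3 * 2 ^ p" by (simp add: power3_eq_cube)
      finally show "t + 6 * P * (t * r) + 126 * P * w \<le> 6240 * P ^ 3 * 2 ^ p" .
    qed simp
    finally show ?thesis using M(3) by linarith
  qed
  \<comment> \<open>The factor \<open>60 * P\<close> that \<open>k\<close> contributes to the
    exponent is given away.\<close>
  moreover have "2 ^ 4 ^ p \<le> boolean_rank (complement_mat M)"
    by (rule order_trans[OF _ M(4)]) (use k2(1) in \<open>intro power_mono; simp\<close>)
  ultimately show ?thesis using that M(1,2) by (simp add: P_def)
qed

text \<open>Only an upper bound on \<open>u\<close> is at hand, although \<open>log 2 u\<close> must
  replace \<open>p\<close>. If \<open>log 2 u\<close> is at least \<open>p / 2\<close>, it does so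
  directly; otherwise \<open>u\<close> is so small that already
  \<open>u\<^sup>2 \<le> 4 ^ p\<close>. Squaring the cube of \<open>p + 1\<close> gives the power
  \<open>6\<close>, and \<open>4096 = 2 ^ 6 * 2 ^ 6\<close> comes from
  \<open>p + 1 \<le> 2 * p\<close> and from \<open>p = 2 * (p / 2)\<close>.\<close>

lemma gap_exponent:
  fixes u :: real
  assumes p: "p \<ge> 1" and u: "2 \<le> u" "u \<le> 6240 * (real p + 1) ^ 3 * 2 ^ p"
  shows "1 / (4096 * 6240\<^sup>2) * u\<^sup>2 \<le> 4 ^ p * log 2 u ^ 6"
proof (cases "log 2 u \<ge> real p / 2")
  case True
  have "(real p + 1) ^ 3 \<le> (2 * real p) ^ 3" using p by (intro power_mono) auto
  then have "6240 * (real p + 1) ^ 3 * 2 ^ p \<le> 6240 * (2 * real p) ^ 3 * 2 ^ p"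
    by (intro mult_right_mono mult_left_mono) auto
  with u(2) have "u \<le> 6240 * (2 * real p) ^ 3 * 2 ^ p" by (rule order_trans)
  then have "u\<^sup>2 \<le> (6240 * (2 * real p) ^ 3 * 2 ^ p)\<^sup>2" using u by (intro power_mono) auto
  also have "\<dots> = 64 * 6240\<^sup>2 * real p ^ 6 * 4 ^ p"
  proof -
    have "(2::real) ^ p * 2 ^ p = 4 ^ p" by (simp flip: power_mult_distrib)
    moreover have "(6240 * (2 * x) ^ 3 * y)\<^sup>2 = 64 * 6240\<^sup>2 * x ^ 6 * (y * y)" for x y :: real
      by (simp add: power_mult_distrib power2_eq_square flip: power_add)
    ultimately show ?thesis by (simp only:)
  qed
  finally have "1 / (4096 * 6240\<^sup>2) * u\<^sup>2 \<le> 4 ^ p * (real p / 2) ^ 6"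
    by (simp add: power_divide field_simps)
  also have "\<dots> \<le> 4 ^ p * log 2 u ^ 6" using True by (intro mult_left_mono power_mono) auto
  finally show ?thesis .
next
  case False
  have "u = 2 powr log 2 u" using u by simp
  also have "\<dots> \<le> 2 powr (p / 2)" using False by (intro powr_mono) auto
  finally have "u\<^sup>2 \<le> (2 powr (p / 2))\<^sup>2" using u by (intro power_mono) auto
  also have "\<dots> = 2 ^ p" by (simp add: power2_eq_square powr_realpow flip: powr_add)
  also have "\<dots> \<le> 4 ^ p" by (intro power_mono) auto
  finally have "1 / (4096 * 6240\<^sup>2) * u\<^sup>2 \<le> 1 * 4 ^ p" by (intro mult_mono) auto
  then have "1 / (4096 * 6240\<^sup>2) * u\<^sup>2 \<le> 4 ^ p * 1" by simp
  also have "\<dots> \<le> 4 ^ p * log 2 u ^ 6"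
  proof -
    have "log 2 u \<ge> 1" using u by simp
    then show ?thesis by (intro mult_left_mono one_le_power) auto
  qed
  finally show ?thesis .
qed

theorem theorem1p1:
  shows "\<exists>(a::real) (b::real). a > 0 \<and> b \<ge> 0 \<and>
    infinite {k::nat. k \<ge> 4 \<and>
      (\<exists>M::real mat. square_mat M \<and> regular_mat M \<and> binary_rank M = k \<and>
         real (boolean_rank (complement_mat M))
           \<ge> real k powr (a * log 2 (real k) / (log 2 (log 2 (real k))) powr b))}"
proof (intro exI conjI)
  let ?a = "1 / (4096 * 6240\<^sup>2) :: real"
  let ?S = "{k::nat. k \<ge> 4 \<and>
      (\<exists>M::real mat. square_mat M \<and> regular_mat M \<and> binary_rank M = k \<and>
         real (boolean_rank (complement_mat M))
           \<ge> real k powr (?a * log 2 (real k) / (log 2 (log 2 (real k))) powr 6))}"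
  have large: "\<exists>k\<in>?S. 4 ^ p \<le> k" if p: "p \<ge> 1" for p
  proof -
    obtain M where M: "square_mat M" "regular_mat M"
        "binary_rank M \<le> 2 ^ (6240 * (p + 1) ^ 3 * 2 ^ p)" "2 ^ 4 ^ p \<le> boolean_rank (complement_mat M)"
      using gap_matrix[OF p] by blast
    \<comment> \<open>The exact binary rank is not computed: it is bounded above by
      \<open>M(3)\<close>, and below by \<open>4 ^ p\<close> through
      \<open>boolean_rank_complement_le\<close>, so it grows with \<open>p\<close>.\<close>
    define k where "k = binary_rank M"
    have "2 ^ 4 ^ p \<le> (2::nat) ^ k"
    proof -
      have "zero_one_mat M" using M(2) by (simp add: regular_mat_def)
      then show ?thesis unfolding k_def by (rule order_trans[OF M(4) boolean_rank_complement_le])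
    qed
    then have pk: "4 ^ p \<le> k" by simp
    have k4: "4 \<le> k" using pk power_increasing[OF p, of "4::nat"] by simp
    define u where "u = log 2 (real k)"
    have u2: "2 \<le> u" using k4 by (simp add: u_def le_log_iff)
    have "real k \<le> 2 powr real (6240 * (p + 1) ^ 3 * 2 ^ p)"
      using M(3) by (metis k_def of_nat_le_iff of_nat_numeral of_nat_power powr_realpow zero_less_numeral)
    then have "u \<le> real (6240 * (p + 1) ^ 3 * 2 ^ p)"
      using k4 unfolding u_def by (subst log_le_iff) auto
    then have u: "u \<le> 6240 * (real p + 1) ^ 3 * 2 ^ p" by (simp add: add.commute)
    have l: "log 2 u > 0" using u2 by simp
    have "?a * u\<^sup>2 \<le> 4 ^ p * log 2 u ^ 6" by (rule gap_exponent[OF p u2 u])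
    then have "?a * u\<^sup>2 / log 2 u powr 6 \<le> 4 ^ p"
      using l by (simp add: pos_divide_le_eq powr_numeral)
    then have "u * (?a * u / log 2 u powr 6) \<le> 4 ^ p" by (simp add: power2_eq_square ac_simps)
    then have "2 powr (u * (?a * u / log 2 u powr 6)) \<le> 2 powr (4 ^ p)" by (intro powr_mono) auto
    also have "\<dots> = real (2 ^ 4 ^ p)" by (simp add: powr_realpow[symmetric])
    also have "\<dots> \<le> real (boolean_rank (complement_mat M))" using M(4) by (simp only: of_nat_le_iff)
    also have "2 powr (u * (?a * u / log 2 u powr 6)) = (2 powr u) powr (?a * u / log 2 u powr 6)"
      by (rule powr_powr[symmetric])
    also have "2 powr u = real k" using k4 by (simp add: u_def)
    finally show ?thesis using M(1,2) k4 pk unfolding u_def k_def by blast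
  qed
  have "n \<le> 4 ^ Suc n" for n :: nat
  proof -
    have "n \<le> 2 ^ n" by (rule less_imp_le[OF less_exp])
    also have "\<dots> \<le> (4::nat) ^ n" by (intro power_mono) auto
    also have "\<dots> \<le> 4 ^ Suc n" by simp
    finally show ?thesis .
  qed
  then have "\<exists>k\<in>?S. n \<le> k" for n
    using large[of "Suc n"] by (auto intro: le_trans)
  then show "infinite ?S" unfolding finite_nat_set_iff_bounded by (meson leD)
qed auto

end
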